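(* Suppose that $\int_0^\infty \sqrt{1-F(x)}\,dx<+\infty$. Then $\gamma(F)<\infty$, and for all $x,t>0$, as $r\to\infty$, $$\frac{\mathbb{E}\, L\big(\mathbf 0,(rx,rt)\big)}{r}\to \gamma(F)\sqrt{xt},$$ and, almost surely, $$\frac{L\big(\mathbf 0,(rx,rt)\big)}{r}\to \gamma(F)\sqrt{xt}.$$
   Context: Let $\mathbf P\subset\mathbb R^2$ be a homogeneous Poisson point process of intensity one, and let $\{\omega_{\mathbf p}:\mathbf p\in\mathbf P\}$ be i.i.d. positive random variables with distribution function $F$, independent of $\mathbf P$. For $\mathbf p\le\mathbf q$ in $\mathbb R^2$ (coordinatewise, $\mathbf p\neq\mathbf q$), $L(\mathbf p,\mathbf q)$ denotes the maximum, over all finite coordinatewise increasing sequences of points of $\mathbf P$ lying in the rectangle $\{\mathbf x: p_1<x_1\le q_1,\ p_2<x_2\le q_2\}$, of the sum of their weights (the empty sum being $0$). Write $\mathbf 0=(0,0)$ and $\gamma(F)=\sup_{n\ge1}\mathbb{E}\,L(\mathbf 0,(n,n))/n$. *)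

theory Defs
  imports "HOL-Probability.Probability"
begin

definition poisson_process :: "'w measure \<Rightarrow> ('w \<Rightarrow> 'b set) \<Rightarrow> 'b measure \<Rightarrow> bool" where
  "poisson_process M PP mu \<longleftrightarrow>
     prob_space M \<and>
     (\<forall>\<omega>\<in>space M. PP \<omega> \<subseteq> space mu) \<and>
     (\<forall>B\<in>sets mu. emeasure mu B < \<infinity> \<longrightarrow>
        (\<lambda>\<omega>. card (PP \<omega> \<inter> B)) \<in> measurable M (count_space UNIV) \<and>
        {\<omega>\<in>space M. finite (PP \<omega> \<inter> B)} \<in> sets M \<and>
        (AE \<omega> in M. finite (PP \<omega> \<inter> B)) \<and>
        (\<forall>k::nat. measure M {\<omega>\<in>space M. card (PP \<omega> \<inter> B) = k}
            = exp (- measure mu B) * measure mu B ^ k / fact k)) \<and>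
     (\<forall>(I::nat set) B. finite I \<longrightarrow> (\<forall>i\<in>I. B i \<in> sets mu \<and> emeasure mu (B i) < \<infinity>)
        \<longrightarrow> disjoint_family_on B I \<longrightarrow>
        prob_space.indep_vars M (\<lambda>_. count_space UNIV) (\<lambda>i \<omega>. card (PP \<omega> \<inter> B i)) I)"

text \<open>Marked Poisson process: points in R^2 with i.i.d. marks of law D, independent
  of the points, is a Poisson process on R^2 x R with intensity Lebesgue x D.\<close>
definition marked_poisson :: "'w measure \<Rightarrow> ('w \<Rightarrow> ((real \<times> real) \<times> real) set) \<Rightarrow> real measure \<Rightarrow> bool" where
  "marked_poisson M Q D \<longleftrightarrow> poisson_process M Q ((lborel :: (real \<times> real) measure) \<Otimes>\<^sub>M D)"

definition lt2 :: "real \<times> real \<Rightarrow> real \<times> real \<Rightarrow> bool" where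
  "lt2 u v \<longleftrightarrow> fst u \<le> fst v \<and> snd u \<le> snd v \<and> u \<noteq> v"

definition in_rect :: "real \<times> real \<Rightarrow> real \<times> real \<Rightarrow> real \<times> real \<Rightarrow> bool" where
  "in_rect p q x \<longleftrightarrow> fst p < fst x \<and> fst x \<le> fst q \<and> snd p < snd x \<and> snd x \<le> snd q"

definition chains :: "((real \<times> real) \<times> real) set \<Rightarrow> real \<times> real \<Rightarrow> real \<times> real \<Rightarrow> ((real \<times> real) \<times> real) list set" where
  "chains Q p q = {xs. set xs \<subseteq> Q \<and> (\<forall>z\<in>set xs. in_rect p q (fst z))
                       \<and> sorted_wrt (\<lambda>a b. lt2 (fst a) (fst b)) xs}"

definition lpp :: "((real \<times> real) \<times> real) set \<Rightarrow> real \<times> real \<Rightarrow> real \<times> real \<Rightarrow> real" where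
  "lpp Q p q = Sup ((\<lambda>xs. sum_list (map snd xs)) ` chains Q p q)"

definition gamma_const :: "'w measure \<Rightarrow> ('w \<Rightarrow> ((real \<times> real) \<times> real) set) \<Rightarrow> ennreal" where
  "gamma_const M Q = (SUP n\<in>{1::nat..}. (\<integral>\<^sup>+\<omega>. ennreal (lpp (Q \<omega>) (0,0) (real n, real n)) \<partial>M) / ennreal (real n))"

end

theory Submission
  imports Defs
begin

text \<open>
  By superadditivity the means \<open>\<bbbE> L(0,(s,s)) / s\<close> converge to \<open>\<gamma>\<close>, and since the law of the passage
  time of a rectangle depends only on its area, so do those of other rectangles. For
  \<open>\<gamma> < \<infinity>\<close>, slice the weights at integer levels, \<open>w \<le> \<Sum>\<^sub>k 1(k < w)\<close>: the points of weight above \<open>k\<close>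
  form a Poisson process of intensity \<open>1 - F(k)\<close>, and a chain meets \<open>O(n \<surd>(1 - F(k)))\<close> of them on average,
  because it is covered by one of exponentially many staircases of squares of Poisson mass at most one.

  The almost sure statement needs no ergodic theorem. Along \<open>r = c 2\<^sup>k\<close> put
  \<open>Y\<^sub>k = max 0 (A 2\<^sup>k - X\<^sub>k)\<close> with \<open>X\<^sub>k\<close> the passage time. Then \<open>Y\<^sub>k\<^sub>+\<^sub>1 \<le> Y\<^sub>k + Y'\<^sub>k\<close> with \<open>Y'\<^sub>k\<close> an independent
  copy of \<open>Y\<^sub>k\<close>, and comparing second moments shows that the variances of \<open>Y\<^sub>k / 2\<^sup>k\<close> are summable
  (Kesten's argument), so \<open>X\<^sub>k / 2\<^sup>k\<close> converges once \<open>A\<close> exceeds the limit of its means.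
  Monotonicity in \<open>r\<close> fills the gaps between the sequences with rational \<open>c\<close>.
\<close>

section \<open>Chains and passage times\<close>

text \<open>The Poisson hypothesis speaks only of counts in finitely many disjoint sets. Invariance
  of the law under maps of the plane and independence of whole sigma-algebras are not given as such.
  Every statement about the law of a passage time is therefore read off from the pattern of occupied
  cells of a finite grid, whose probabilities are explicit products, and carried to the limit for
  bounded continuous functions. Equality of laws and independence thus appear only as identities
  between expectations, and the doubling argument is phrased so as to consume nothing more.

  The square root in the hypothesis is a length scale: at intensity 1 - F(k) a square of mass one
  has side 1 / sqrt(1 - F(k)), and a chain across a square of side n meets about n sqrt(1 - F(k))
  such squares. Summed over the levels k this is comparable with the integral. Only the first moment
  of the passage time is controlled in this way, so second moments enter for truncated variables
  alone.\<close>

definition rect :: "real \<times> real \<Rightarrow> real \<times> real \<Rightarrow> ((real \<times> real) \<times> real) set" where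
  "rect p q = {z. in_rect p q (fst z)}"

lemma lt2_irrefl: "\<not> lt2 u u"
  by (simp add: lt2_def)

lemma chains_distinct:
  assumes "xs \<in> chains Q p q"
  shows "distinct xs"
proof -
  have "sorted_wrt (\<lambda>a b. lt2 (fst a) (fst b)) xs \<Longrightarrow> distinct xs"
    by (induction xs) (auto simp: lt2_irrefl)
  then show ?thesis using assms by (simp add: chains_def)
qed

lemma chains_subset: "xs \<in> chains Q p q \<Longrightarrow> set xs \<subseteq> Q \<inter> rect p q"
  by (auto simp: chains_def rect_def)

lemma finite_chains:
  assumes "finite (Q \<inter> rect p q)"
  shows "finite (chains Q p q)"
  by (rule finite_subset[OF _ finite_subset_distinct[OF assms]])
     (use chains_subset chains_distinct in blast)

lemma Nil_in_chains: "[] \<in> chains Q p q"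
  by (simp add: chains_def)

lemma lpp_ge:
  assumes "finite (Q \<inter> rect p q)" "xs \<in> chains Q p q"
  shows "sum_list (map snd xs) \<le> lpp Q p q"
  unfolding lpp_def using assms
  by (intro cSup_upper bdd_above_finite finite_imageI finite_chains) auto

lemma lpp_le:
  assumes "\<And>xs. xs \<in> chains Q p q \<Longrightarrow> sum_list (map snd xs) \<le> c"
  shows "lpp Q p q \<le> c"
  unfolding lpp_def using assms Nil_in_chains[of Q p q] by (intro cSup_least) auto

lemma lpp_nonneg:
  assumes "finite (Q \<inter> rect p q)"
  shows "0 \<le> lpp Q p q"
  using lpp_ge[OF assms Nil_in_chains] by simp

lemma lpp_attained:
  assumes "finite (Q \<inter> rect p q)"
  obtains xs where "xs \<in> chains Q p q" "lpp Q p q = sum_list (map snd xs)"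
proof -
  have "lpp Q p q \<in> (\<lambda>xs. sum_list (map snd xs)) ` chains Q p q"
    unfolding lpp_def using Nil_in_chains[of Q p q] finite_chains[OF assms]
    by (intro closed_contains_Sup bdd_above_finite finite_imageI finite_imp_closed) auto
  then show ?thesis using that by auto
qed

lemma lpp_mono:
  assumes "finite (Q \<inter> rect p q')" "fst q \<le> fst q'" "snd q \<le> snd q'"
  shows "lpp Q p q \<le> lpp Q p q'"
proof (rule lpp_le)
  fix xs assume "xs \<in> chains Q p q"
  then have "xs \<in> chains Q p q'"
    using assms(2,3) by (force simp: chains_def in_rect_def)
  then show "sum_list (map snd xs) \<le> lpp Q p q'" by (rule lpp_ge[OF assms(1)])
qed

text \<open>Optimal chains concatenate because the rectangles are half open: a point of the lower
  one is strictly left of and below every point of the upper one, so the order is kept and no point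
  is counted twice.\<close>

lemma lpp_superadditive:
  assumes fin: "finite (Q \<inter> rect p r)"
    and "fst p \<le> fst q" "snd p \<le> snd q" "fst q \<le> fst r" "snd q \<le> snd r"
  shows "lpp Q p q + lpp Q q r \<le> lpp Q p r"
proof -
  have "finite (Q \<inter> rect p q)" "finite (Q \<inter> rect q r)"
    by (rule finite_subset[OF _ fin], use assms in \<open>force simp: rect_def in_rect_def\<close>)+
  then obtain xs ys where
    xs: "xs \<in> chains Q p q" "lpp Q p q = sum_list (map snd xs)" and
    ys: "ys \<in> chains Q q r" "lpp Q q r = sum_list (map snd ys)"
    by (metis lpp_attained)
  have "lt2 (fst a) (fst b)" if "a \<in> set xs" "b \<in> set ys" for a b
    using that xs(1) ys(1) by (force simp: chains_def lt2_def in_rect_def)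
  then have "xs @ ys \<in> chains Q p r"
    using xs(1) ys(1) assms(2-) by (force simp: chains_def in_rect_def sorted_wrt_append)
  from lpp_ge[OF fin this] show ?thesis by (simp add: xs(2) ys(2))
qed

text \<open>Made for rounding. An order preserving \<open>f\<close> carries chains to chains, and an
  error of \<open>d\<close> per point adds up to at most \<open>d\<close> times the number of
  points, because chains have distinct entries.\<close>

lemma lpp_compare:
  assumes fin: "finite (Q \<inter> rect p q)" "finite (Q' \<inter> rect p' q')"
    and f: "\<And>z. z \<in> Q \<inter> rect p q \<Longrightarrow> f z \<in> Q' \<inter> rect p' q'"
    and lt: "\<And>z z'. \<lbrakk>z \<in> Q \<inter> rect p q; z' \<in> Q \<inter> rect p q; lt2 (fst z) (fst z')\<rbrakk>
          \<Longrightarrow> lt2 (fst (f z)) (fst (f z'))"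
    and w: "\<And>z. z \<in> Q \<inter> rect p q \<Longrightarrow> snd z \<le> snd (f z) + d" and d: "0 \<le> d"
  shows "lpp Q p q \<le> lpp Q' p' q' + real (card (Q \<inter> rect p q)) * d"
proof (rule lpp_le)
  fix xs assume xs: "xs \<in> chains Q p q"
  note sub = chains_subset[OF xs]
  have srt: "sorted_wrt (\<lambda>a b. lt2 (fst a) (fst b)) xs" using xs by (simp add: chains_def)
  have "sorted_wrt (\<lambda>a b. lt2 (fst (f a)) (fst (f b))) xs"
    by (rule sorted_wrt_mono_rel[OF _ srt]) (use sub lt in blast)
  then have "map f xs \<in> chains Q' p' q'"
    using f sub by (force simp: chains_def rect_def sorted_wrt_map)
  from lpp_ge[OF fin(2) this] have 1: "sum_list (map (snd \<circ> f) xs) \<le> lpp Q' p' q'"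
    by (simp add: o_def)
  have "length xs = card (set xs)" using chains_distinct[OF xs] by (simp add: distinct_card)
  also have "\<dots> \<le> card (Q \<inter> rect p q)" using fin(1) sub by (rule card_mono)
  finally have "real (length xs) * d \<le> real (card (Q \<inter> rect p q)) * d"
    using d by (intro mult_right_mono) auto
  moreover have "sum_list (map snd xs) \<le> sum_list (map (\<lambda>z. (snd \<circ> f) z + d) xs)"
    proof (rule sum_list_mono)
    fix z assume "z \<in> set xs"
    with sub have "z \<in> Q \<inter> rect p q" by blast
    from w[OF this] show "snd z \<le> (snd \<circ> f) z + d" by simp
  qed
  ultimately show "sum_list (map snd xs) \<le> lpp Q' p' q' + real (card (Q \<inter> rect p q)) * d"
    using 1 by (simp add: sum_list_addf sum_list_triv o_def)
qed

section \<open>Superadditive sequences and interpolation\<close>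

lemma superadditive_mult_le:
  fixes f :: "real \<Rightarrow> real"
  assumes "\<And>s t. \<lbrakk>0 < s; 0 < t\<rbrakk> \<Longrightarrow> f s + f t \<le> f (s + t)" and s: "0 < s"
  shows "real (Suc n) * f s \<le> f (real (Suc n) * s)"
proof (induction n)
  case (Suc n)
  have "0 < real (Suc n) * s" using s by (simp del: of_nat_Suc)
  then show ?case using Suc assms(1)[of "real (Suc n) * s" s] s by (simp add: algebra_simps)
qed simp

text \<open>Fekete's argument with a real parameter, where \<open>g\<close> is tied to
  \<open>f\<close> only at the integers, as in the supremum defining \<gamma>. Nonnegativity and
  superadditivity make \<open>f\<close> monotone, which bridges the gaps between integers.\<close>

lemma superadditive_limit:
  fixes f :: "real \<Rightarrow> real" and g :: real
  assumes nonneg: "\<And>s. 0 < s \<Longrightarrow> 0 \<le> f s"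
    and super: "\<And>s t. \<lbrakk>0 < s; 0 < t\<rbrakk> \<Longrightarrow> f s + f t \<le> f (s + t)"
    and le: "\<And>n. 1 \<le> n \<Longrightarrow> f (real n) \<le> g * real n"
    and sup: "\<And>e. 0 < e \<Longrightarrow> \<exists>n\<ge>1. g - e < f (real n) / real n"
  shows "((\<lambda>s. f s / s) \<longlongrightarrow> g) at_top" and "0 < s \<Longrightarrow> f s \<le> g * s"
proof -
  have mono: "f s \<le> f t" if "0 < s" "s \<le> t" for s t
    using super[of s "t - s"] nonneg[of "t - s"] that by (cases "s = t") auto
  have g0: "0 \<le> g" using le[of 1] nonneg[of 1] by simp
  have div0: "((\<lambda>s::real. c / s) \<longlongrightarrow> 0) at_top" for c :: real
    by (intro tendsto_divide_0[OF tendsto_const] filterlim_at_top_imp_at_infinity filterlim_ident)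
  show lim: "((\<lambda>s. f s / s) \<longlongrightarrow> g) at_top"
  proof (rule order_tendstoI)
    fix a assume "g < a"
    have "((\<lambda>s::real. g + g / s) \<longlongrightarrow> g + 0) at_top"
      by (intro tendsto_add tendsto_const div0)
    then have "\<forall>\<^sub>F s in at_top. g + g / s < a" using \<open>g < a\<close> by (intro order_tendstoD) auto
    then show "\<forall>\<^sub>F s in at_top. f s / s < a"
      using eventually_gt_at_top[of 0]
    proof eventually_elim
      case (elim s)
      have "f s \<le> f (real (nat \<lceil>s\<rceil>))" using elim by (intro mono) linarith+
      also have "\<dots> \<le> g * real (nat \<lceil>s\<rceil>)" using elim by (intro le) linarith
      also have "\<dots> \<le> g * (s + 1)" using elim g0 by (intro mult_left_mono) linarith+
      finally have "f s / s \<le> g * (s + 1) / s" using elim by (intro divide_right_mono) auto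
      also have "\<dots> = g + g / s" using elim by (simp add: field_simps)
      finally show ?case using elim by simp
    qed
  next
    fix a assume "a < g"
    then obtain n where n: "1 \<le> n" "a < f (real n) / real n" using sup[of "g - a"] by auto
    have "((\<lambda>s::real. f (real n) / real n - f (real n) / s) \<longlongrightarrow> f (real n) / real n - 0) at_top"
      by (intro tendsto_diff tendsto_const div0)
    then have "\<forall>\<^sub>F s in at_top. a < f (real n) / real n - f (real n) / s"
      using n by (intro order_tendstoD) auto
    then show "\<forall>\<^sub>F s in at_top. a < f s / s"
      using eventually_ge_at_top[of "real n"]
    proof eventually_elim
      case (elim s)
      have s0: "0 < s" using n elim by linarith
      define m where "m = nat \<lfloor>s / n\<rfloor>"
      have "1 \<le> s / n" using n elim by (simp add: field_simps)
      then have m: "s / n - 1 \<le> real m" "real m \<le> s / n" "1 \<le> m" unfolding m_def by linarith+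
      have "(s / n - 1) * f (real n) \<le> real m * f (real n)"
        using m(1) nonneg[of "real n"] n by (intro mult_right_mono) auto
      also have "\<dots> \<le> f (real m * real n)"
        using superadditive_mult_le[of f "real n" "m - 1", OF super] n m by simp
      also have "\<dots> \<le> f s" using m n by (intro mono) (auto simp: field_simps)
      finally have "(s / n - 1) * f (real n) / s \<le> f s / s" using s0 by (intro divide_right_mono) auto
      moreover have "(s / n - 1) * f (real n) / s = f (real n) / real n - f (real n) / s"
        using s0 n by (simp add: field_simps)
      ultimately show ?case using elim by simp
    qed
  qed
  assume s: "0 < s"
  \<comment> \<open>For real \<open>s\<close> the bound is recovered from the limit: the quotients
    at the multiples of \<open>s\<close> all dominate \<open>f s / s\<close> and converge to
    \<open>g\<close>.\<close>
  have "filterlim (\<lambda>n. real (Suc n) * s) at_top sequentially"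
    by (intro filterlim_at_top_mult_tendsto_pos[OF tendsto_const s] 
          filterlim_compose[OF filterlim_real_sequentially filterlim_Suc])
  from filterlim_compose[OF lim this]
  have "(\<lambda>n. f (real (Suc n) * s) / (real (Suc n) * s)) \<longlonglongrightarrow> g" .
  then have "f s / s \<le> g"
  proof (rule LIMSEQ_le_const, intro exI allI impI)
    fix n :: nat
    have "f s / s = real (Suc n) * f s / (real (Suc n) * s)" by (simp del: of_nat_Suc)
    also have "\<dots> \<le> f (real (Suc n) * s) / (real (Suc n) * s)"
      using s by (intro divide_right_mono superadditive_mult_le super) auto
    finally show "f s / s \<le> f (real (Suc n) * s) / (real (Suc n) * s)" .
  qed
  then show "f s \<le> g * s" using s by (simp add: field_simps)
qed

lemma dyadic_interpolation:
  fixes f :: "real \<Rightarrow> real" and g :: real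
  assumes mono: "\<And>r s. \<lbrakk>0 < r; r \<le> s\<rbrakk> \<Longrightarrow> f r \<le> f s" and g: "0 \<le> g"
    and lim: "\<And>c. \<lbrakk>c \<in> \<rat>; 0 < c\<rbrakk> \<Longrightarrow> (\<lambda>k. f (c * 2 ^ k) / 2 ^ k) \<longlonglongrightarrow> g * c"
  shows "((\<lambda>r. f r / r) \<longlongrightarrow> g) at_top"
proof (rule tendstoI)
  fix e :: real assume e: "0 < e"
  \<comment> \<open>The final error \<open>(g + 1) / m\<close> has two sources: \<open>g / m\<close>
    from the spacing of the ratios \<open>c j\<close>, and \<open>1 / m\<close> from the accuracy
    asked of each sequence. Only the \<open>m + 1\<close> rational ratios between 1 and 2 enter, so
    a single threshold \<open>K\<close> serves them all.\<close>
  obtain m' where m': "(g + 1) / e < real m'" using reals_Archimedean2 by blast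
  define m where "m = Suc m'"
  have m: "0 < real m" "(g + 1) / real m < e"
    using m' e g by (auto simp: m_def field_simps)
  define c where "c j = 1 + real j / real m" for j
  have "\<forall>j\<in>{..m}. \<forall>\<^sub>F k in sequentially. dist (f (c j * 2 ^ k) / 2 ^ k) (g * c j) < 1 / m"
    using m by (intro ballI tendstoD lim) (auto simp: c_def add_pos_nonneg)
  then have "\<forall>\<^sub>F k in sequentially. \<forall>j\<in>{..m}. dist (f (c j * 2 ^ k) / 2 ^ k) (g * c j) < 1 / m"
    by (simp add: eventually_ball_finite_distrib)
  then obtain K where K: "\<And>k j. K \<le> k \<Longrightarrow> j \<le> m \<Longrightarrow> \<bar>f (c j * 2 ^ k) / 2 ^ k - g * c j\<bar> < 1 / m"
    by (auto simp: eventually_sequentially dist_real_def)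
  show "\<forall>\<^sub>F r in at_top. dist (f r / r) g < e"
  proof (rule eventually_at_top_linorderI)
    fix r :: real assume r: "2 ^ K \<le> r"
    have r1: "1 \<le> r" using r by (meson one_le_numeral one_le_power order_trans)
    define n where "n = (LEAST n. r < 2 ^ n)"
    have ex: "\<exists>n. r < 2 ^ n" using real_arch_pow[of 2 r] by auto
    have n: "r < 2 ^ n" unfolding n_def by (rule LeastI_ex[OF ex])
    have "n \<noteq> 0" using n r1 by (intro notI) simp
    then obtain k where k: "n = Suc k" by (cases n) auto
    have k1: "2 ^ k \<le> r" using not_less_Least[of k "\<lambda>n. r < 2 ^ n"] k by (simp add: n_def)
    have k2: "r < 2 * 2 ^ k" using n k by simp
    have "(2::real) ^ K < 2 ^ Suc k" using r n k by simp
    then have "K < Suc k" by (rule power_less_imp_less_exp[rotated]) simp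
    then have Kk: "K \<le> k" by simp
    define u where "u = r / 2 ^ k"
    have u: "1 \<le> u" "u < 2" "r = u * 2 ^ k" using k1 k2 by (auto simp: u_def field_simps)
    define j where "j = nat \<lfloor>(u - 1) * m\<rfloor>"
    have "0 \<le> (u - 1) * m" using u m by simp
    then have j: "real j \<le> (u - 1) * m" "(u - 1) * m < real j + 1"
      unfolding j_def by linarith+
    have "(u - 1) * real m < 1 * real m" using u m by (intro mult_strict_right_mono) auto
    then have jm: "Suc j \<le> m" using j(1) by linarith
    have c1: "c j \<le> u" using j(1) m by (simp add: c_def field_simps)
    have c2: "u \<le> c (Suc j)" using j(2) m by (simp add: c_def field_simps)
    have cS: "c (Suc j) = c j + 1 / m" by (simp add: c_def add_divide_distrib)
    have cpos: "0 < c j" by (simp add: c_def add_pos_nonneg)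
    have gc: "g * c j \<le> g * u" "g * u \<le> g * c j + g / m"
      using c1 c2 g mult_left_mono[of u "c (Suc j)" g] by (auto simp: cS distrib_left mult_left_mono)
    have "f r / 2 ^ k \<le> f (c (Suc j) * 2 ^ k) / 2 ^ k"
      using c2 r1 u by (intro divide_right_mono mono) auto
    also have "\<dots> \<le> g * c (Suc j) + 1 / m" using K[OF Kk jm] by (simp add: abs_less_iff)
    finally have up: "f r / 2 ^ k - g * u \<le> (g + 1) / m"
      using gc by (simp add: cS distrib_left add_divide_distrib)
    have "g * c j - 1 / m \<le> f (c j * 2 ^ k) / 2 ^ k" using K[OF Kk, of j] jm by (simp add: abs_less_iff)
    also have "\<dots> \<le> f r / 2 ^ k" using c1 cpos u by (intro divide_right_mono mono) auto
    finally have lo: "- ((g + 1) / m) \<le> f r / 2 ^ k - g * u"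
      using gc by (simp add: add_divide_distrib diff_divide_distrib)
    have "\<bar>f r / r - g\<bar> = \<bar>f r / 2 ^ k - g * u\<bar> / u"
      using u by (simp add: field_simps abs_divide flip: abs_of_pos)
    also have "\<dots> \<le> \<bar>f r / 2 ^ k - g * u\<bar> / 1" using u by (intro divide_left_mono) auto
    also have "\<dots> \<le> (g + 1) / m"
      using up lo unfolding div_by_1 abs_le_iff by linarith
    also have "\<dots> < e" by (rule m)
    finally show "dist (f r / r) g < e" by (simp add: dist_real_def)
  qed
qed

text \<open>The series has a finite integral, hence converges almost everywhere. Applied to squared
  deviations, this takes the place of Chebyshev's inequality with Borel-Cantelli.\<close>

lemma nonneg_summable_integral_imp_AE_tendsto_0:
  fixes Z :: "nat \<Rightarrow> 'a \<Rightarrow> real"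
  assumes Z: "\<And>k. integrable M (Z k)" "\<And>k x. 0 \<le> Z k x"
    and b: "\<And>n. (\<Sum>k<n. integral\<^sup>L M (Z k)) \<le> C"
  shows "AE x in M. (\<lambda>k. Z k x) \<longlonglongrightarrow> 0"
proof -
  have [measurable]: "Z k \<in> borel_measurable M" for k using Z(1) by auto
  have "(\<integral>\<^sup>+x. (\<Sum>k. ennreal (Z k x)) \<partial>M) = (\<Sum>k. \<integral>\<^sup>+x. ennreal (Z k x) \<partial>M)"
    by (rule nn_integral_suminf) measurable
  also have "\<dots> = (\<Sum>k. ennreal (integral\<^sup>L M (Z k)))"
    using Z by (simp add: nn_integral_eq_integral)
  also have "\<dots> \<le> ennreal C"
  proof (rule suminf_le_const)
    fix n show "(\<Sum>k<n. ennreal (integral\<^sup>L M (Z k))) \<le> ennreal C"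
      using b[of n] Z(2) by (subst sum_ennreal) (auto intro: integral_nonneg ennreal_leI)
  qed simp
  finally have "(\<integral>\<^sup>+x. (\<Sum>k. ennreal (Z k x)) \<partial>M) \<noteq> \<infinity>"
    by (auto simp: top_unique)
  then have "AE x in M. (\<Sum>k. ennreal (Z k x)) \<noteq> \<infinity>"
    by (intro nn_integral_PInf_AE) auto
  then show ?thesis
  proof eventually_elim
    case (elim x)
    then have "summable (\<lambda>k. Z k x)"
      using Z(2) by (intro summable_suminf_not_top) auto
    then show ?case by (rule summable_LIMSEQ_zero)
  qed
qed

section \<open>Almost sure convergence along doubling sequences\<close>

context prob_space begin

text \<open>Equality of laws and independence are demanded only through the expectations that occur
  when the subadditive inequality is squared. At one fixed level \<open>A\<close> the limit is only
  seen to be at most \<open>c\<close>; the last conjunct is what allows levels to be compared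
  afterwards in order to exclude a smaller limit.\<close>

lemma doubling_truncated:
  fixes X X' :: "nat \<Rightarrow> 'a \<Rightarrow> real" and c A :: real
  assumes meas[measurable]: "\<And>k. X k \<in> borel_measurable M" "\<And>k. X' k \<in> borel_measurable M"
    and int: "\<And>k. integrable M (X k)"
    and nonneg: "\<And>k x. 0 \<le> X k x" "\<And>k x. 0 \<le> X' k x"
    and super: "\<And>k. AE x in M. X k x + X' k x \<le> X (Suc k) x"
    and law1: "\<And>a k. expectation (\<lambda>x. max 0 (a - X' k x)) = expectation (\<lambda>x. max 0 (a - X k x))"
    and law2: "\<And>a k. expectation (\<lambda>x. (max 0 (a - X' k x))\<^sup>2) = expectation (\<lambda>x. (max 0 (a - X k x))\<^sup>2)"
    and indep: "\<And>a k. expectation (\<lambda>x. max 0 (a - X k x) * max 0 (a - X' k x))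
       = expectation (\<lambda>x. max 0 (a - X k x)) * expectation (\<lambda>x. max 0 (a - X' k x))"
    and mean: "\<And>k. expectation (X k) \<le> c * 2 ^ k" and A: "c < A"
  shows "\<exists>g. (AE x in M. (\<lambda>k. X k x / 2 ^ k) \<longlonglongrightarrow> g) \<and> g \<le> c \<and>
    (\<forall>k. expectation (\<lambda>x. min A (X k x / 2 ^ k)) \<le> g)"
proof -
  \<comment> \<open>Truncation from above turns the superadditive \<open>X\<close> into a bounded, nonnegative and subadditive
    \<open>Y\<close>; squaring \<open>Y\<^sub>k\<^sub>+\<^sub>1 \<le> Y\<^sub>k + Y'\<^sub>k\<close> then makes the normalised variances summable.\<close>
  define Y where "Y k x = max 0 (A * 2 ^ k - X k x)" for k x
  define Y' where "Y' k x = max 0 (A * 2 ^ k - X' k x)" for k x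
  define m where "m k = expectation (Y k) / 2 ^ k" for k
  define s where "s k = expectation (\<lambda>x. (Y k x)\<^sup>2) / 4 ^ k" for k
  have "0 \<le> expectation (X 0)" by (rule Bochner_Integration.integral_nonneg) (rule nonneg)
  then have c0: "0 \<le> c" using mean[of 0] by simp
  have four: "(4::real) ^ k = (2 ^ k)\<^sup>2" for k
    by (simp add: power2_eq_square flip: power_mult_distrib)
  have A0: "0 < A" using c0 A by simp
  have [measurable]: "Y k \<in> borel_measurable M" "Y' k \<in> borel_measurable M" for k
    unfolding Y_def Y'_def by measurable
  have Yb: "0 \<le> Y k x" "Y k x \<le> A * 2 ^ k" "0 \<le> Y' k x" "Y' k x \<le> A * 2 ^ k" for k x
    using A0 nonneg[of k x] by (auto simp: Y_def Y'_def)
  have iY: "integrable M (Y k)" "integrable M (Y' k)" for k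
    using Yb A0 by (auto intro!: integrable_const_bound[where B = "A * 2 ^ k"])
  have iYY: "integrable M (\<lambda>x. (Y k x)\<^sup>2)" "integrable M (\<lambda>x. (Y' k x)\<^sup>2)"
      "integrable M (\<lambda>x. Y k x * Y' k x)" for k
    using Yb A0 by (auto intro!: integrable_const_bound[where B = "A * 2 ^ k * (A * 2 ^ k)"] AE_I2 mult_mono
         simp: power2_eq_square abs_mult)
  have sub: "AE x in M. Y (Suc k) x \<le> Y k x + Y' k x" for k
    using super[of k] by eventually_elim (auto simp: Y_def Y'_def)
  have EY': "expectation (Y' k) = expectation (Y k)"
       "expectation (\<lambda>x. (Y' k x)\<^sup>2) = expectation (\<lambda>x. (Y k x)\<^sup>2)"
       "expectation (\<lambda>x. Y k x * Y' k x) = (expectation (Y k))\<^sup>2" for k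
    using law1[of "A * 2 ^ k" k] law2[of "A * 2 ^ k" k] indep[of "A * 2 ^ k" k]
    unfolding Y_def Y'_def by (simp_all add: power2_eq_square)
  have "expectation (Y (Suc k)) \<le> expectation (\<lambda>x. Y k x + Y' k x)" for k
    using sub iY by (intro integral_mono_AE) auto
  then have m_step: "m (Suc k) \<le> m k" for k
    using iY EY' by (simp add: m_def field_simps)
  have "expectation (\<lambda>x. (Y (Suc k) x)\<^sup>2) \<le> 2 * expectation (\<lambda>x. (Y k x)\<^sup>2) + 2 * (expectation (Y k))\<^sup>2" for k
  proof -
    have "expectation (\<lambda>x. (Y (Suc k) x)\<^sup>2) \<le> expectation (\<lambda>x. (Y k x)\<^sup>2 + 2 * (Y k x * Y' k x) + (Y' k x)\<^sup>2)"
    proof (rule integral_mono_AE)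
      show "AE x in M. (Y (Suc k) x)\<^sup>2 \<le> (Y k x)\<^sup>2 + 2 * (Y k x * Y' k x) + (Y' k x)\<^sup>2"
        using sub[of k]
      proof eventually_elim
        case (elim x)
        then have "(Y (Suc k) x)\<^sup>2 \<le> (Y k x + Y' k x)\<^sup>2" using Yb by (intro power_mono) auto
        then show ?case by (simp add: power2_sum)
      qed
    qed (use iYY in auto)
    also have "\<dots> = 2 * expectation (\<lambda>x. (Y k x)\<^sup>2) + 2 * (expectation (Y k))\<^sup>2"
      using iYY EY' by simp
    finally show ?thesis .
  qed
  then have s_step: "s (Suc k) \<le> s k / 2 + (m k)\<^sup>2 / 2" for k
    unfolding s_def m_def four power_divide by (simp add: field_simps)
  define v where "v k = s k - (m k)\<^sup>2" for k
  have sq: "(Y k x / 2 ^ k - m k)\<^sup>2 = (Y k x)\<^sup>2 / 4 ^ k - 2 * m k / 2 ^ k * Y k x + (m k)\<^sup>2" for k x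
    by (simp add: power2_diff power_divide four)
  have v_eq: "v k = expectation (\<lambda>x. (Y k x / 2 ^ k - m k)\<^sup>2)" for k
  proof -
    have "expectation (\<lambda>x. (Y k x / 2 ^ k - m k)\<^sup>2)
       = expectation (\<lambda>x. (Y k x)\<^sup>2 / 4 ^ k - 2 * m k / 2 ^ k * Y k x + (m k)\<^sup>2)"
      by (simp add: sq)
    also have "\<dots> = s k - 2 * m k * m k + (m k)\<^sup>2"
      using iYY iY by (simp add: s_def m_def prob_space)
    finally show ?thesis by (simp add: v_def power2_eq_square)
  qed
  have v_nonneg: "0 \<le> v k" for k unfolding v_eq by simp
  \<comment> \<open>The factor 1/2 is the effect of averaging two independent copies. The remainder
    is the drop of the squared means, which telescopes over \<open>k\<close>.\<close>
  have v_step: "v (Suc k) \<le> v k / 2 + ((m k)\<^sup>2 - (m (Suc k))\<^sup>2)" for k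
    using s_step[of k] by (simp add: v_def field_simps)
  \<comment> \<open>By \<open>v_step\<close> the left-hand side does not increase with
    \<open>n\<close>: after doubling, the halved variance leaves exactly one \<open>v n\<close> to
    pay for the new summand.\<close>
  have "2 * v n + (\<Sum>k<n. v k) + 2 * (m n)\<^sup>2 \<le> 2 * v 0 + 2 * (m 0)\<^sup>2" for n
  proof (induction n)
    case (Suc n)
    then show ?case using v_step[of n] by simp
  qed simp
  then have v_sum: "(\<Sum>k<n. v k) \<le> 2 * v 0 + 2 * (m 0)\<^sup>2" for n
    using v_nonneg[of n] by (smt (verit) zero_le_power2)
  have "AE x in M. (\<lambda>k. (Y k x / 2 ^ k - m k)\<^sup>2) \<longlonglongrightarrow> 0"
  proof (rule nonneg_summable_integral_imp_AE_tendsto_0)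
    fix k 
    show "integrable M (\<lambda>x. (Y k x / 2 ^ k - m k)\<^sup>2)" unfolding sq using iYY iY by simp
  qed (use v_sum v_eq in auto)
  then have conv: "AE x in M. (\<lambda>k. Y k x / 2 ^ k - m k) \<longlonglongrightarrow> 0"
    by eventually_elim (simp add: power_tendsto_0_iff)
  have m0: "0 \<le> m k" for k unfolding m_def using Yb by simp
  have "decseq m" using m_step by (rule decseq_SucI)
  from decseq_convergent[OF this, of 0] m0 obtain mu where mu: "m \<longlonglongrightarrow> mu" "\<And>k. mu \<le> m k"
    by blast
  have min_eq: "Y k x / 2 ^ k = A - min A (X k x / 2 ^ k)" for k x
    by (auto simp: Y_def min_def max_def field_simps)
  have imin: "integrable M (\<lambda>x. min A (X k x / 2 ^ k))" for k
  proof -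
    have "(\<lambda>x. min A (X k x / 2 ^ k)) = (\<lambda>x. A - Y k x / 2 ^ k)" using min_eq by auto
    then show ?thesis using iY by simp
  qed
  have m_eq: "m k = A - expectation (\<lambda>x. min A (X k x / 2 ^ k))" for k
  proof -
    have "m k = expectation (\<lambda>x. Y k x / 2 ^ k)" by (simp add: m_def)
    then show ?thesis using imin by (simp add: min_eq prob_space)
  qed
  have "A - c \<le> m k" for k
  proof -
    have "expectation (\<lambda>x. min A (X k x / 2 ^ k)) \<le> expectation (\<lambda>x. X k x / 2 ^ k)"
      using imin int by (intro integral_mono) auto
    also have "\<dots> \<le> c" using mean[of k] by (simp add: field_simps)
    finally show ?thesis by (simp add: m_eq)
  qed
  then have mu_ge: "A - c \<le> mu" by (intro LIMSEQ_le_const[OF mu(1)]) auto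
  show ?thesis
  proof (intro exI[of _ "A - mu"] conjI allI)
    show "A - mu \<le> c" using mu_ge by simp
    show "expectation (\<lambda>x. min A (X k x / 2 ^ k)) \<le> A - mu" for k
      using mu(2)[of k] by (simp add: m_eq)
    show "AE x in M. (\<lambda>k. X k x / 2 ^ k) \<longlonglongrightarrow> A - mu"
      using conv
    proof eventually_elim
      case (elim x)
      have "(\<lambda>k. Y k x / 2 ^ k) \<longlonglongrightarrow> mu"
        using tendsto_add[OF elim mu(1)] by simp
      then have l: "(\<lambda>k. min A (X k x / 2 ^ k)) \<longlonglongrightarrow> A - mu"
        using tendsto_diff[OF tendsto_const[of A]] by (fastforce simp: min_eq)
      have "\<forall>\<^sub>F k in sequentially. min A (X k x / 2 ^ k) < A"
        using order_tendstoD(2)[OF l, of A] mu_ge A by simp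
      then have "\<forall>\<^sub>F k in sequentially. min A (X k x / 2 ^ k) = X k x / 2 ^ k"
        by eventually_elim auto
      with l show ?case by (rule Lim_transform_eventually)
    qed
  qed
qed

text \<open>No integrability beyond the first moment is needed: the truncation level \<open>A\<close> is arbitrary
  above \<open>c\<close>, and the almost sure limit does not depend on it.\<close>

lemma doubling_AE_tendsto:
  fixes X X' :: "nat \<Rightarrow> 'a \<Rightarrow> real" and c :: real
  assumes meas[measurable]: "\<And>k. X k \<in> borel_measurable M" "\<And>k. X' k \<in> borel_measurable M"
    and int: "\<And>k. integrable M (X k)"
    and nonneg: "\<And>k x. 0 \<le> X k x" "\<And>k x. 0 \<le> X' k x"
    and super: "\<And>k. AE x in M. X k x + X' k x \<le> X (Suc k) x"
    and law1: "\<And>a k. expectation (\<lambda>x. max 0 (a - X' k x)) = expectation (\<lambda>x. max 0 (a - X k x))"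
    and law2: "\<And>a k. expectation (\<lambda>x. (max 0 (a - X' k x))\<^sup>2) = expectation (\<lambda>x. (max 0 (a - X k x))\<^sup>2)"
    and indep: "\<And>a k. expectation (\<lambda>x. max 0 (a - X k x) * max 0 (a - X' k x))
       = expectation (\<lambda>x. max 0 (a - X k x)) * expectation (\<lambda>x. max 0 (a - X' k x))"
    and mean: "\<And>k. expectation (X k) \<le> c * 2 ^ k"
    and lim: "(\<lambda>k. expectation (X k) / 2 ^ k) \<longlonglongrightarrow> c"
  shows "AE x in M. (\<lambda>k. X k x / 2 ^ k) \<longlonglongrightarrow> c"
proof -
  note tr = doubling_truncated[of X X' c, OF meas int nonneg super law1 law2 indep mean]
  obtain g where g: "AE x in M. (\<lambda>k. X k x / 2 ^ k) \<longlonglongrightarrow> g" "g \<le> c"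
    using tr[OF less_add_one] by blast
  have le: "expectation (\<lambda>x. min A (X k x / 2 ^ k)) \<le> g" if A: "c < A" for A k
  proof -
    obtain h where h: "AE x in M. (\<lambda>k. X k x / 2 ^ k) \<longlonglongrightarrow> h"
      "\<And>k. expectation (\<lambda>x. min A (X k x / 2 ^ k)) \<le> h"
      using tr[OF A] by blast
    from h(1) g(1) have "AE x in M. g = h"
      by eventually_elim (rule LIMSEQ_unique)
    then have "g = h" by simp
    with h(2) show ?thesis by simp
  qed
  have "expectation (X k) / 2 ^ k \<le> g" for k
  proof -
    \<comment> \<open>Raising the level removes the truncation by dominated convergence, so
      \<open>g\<close> also bounds the untruncated normalised means, whose limit is
      \<open>c\<close>.\<close>
    have "(\<lambda>n. expectation (\<lambda>x. min (c + 1 + real n) (X k x / 2 ^ k))) \<longlonglongrightarrow> expectation (\<lambda>x. X k x / 2 ^ k)"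
    proof (rule integral_dominated_convergence[where w = "\<lambda>x. \<bar>c + 1\<bar> + X k x / 2 ^ k"])
      show "AE x in M. (\<lambda>n. min (c + 1 + real n) (X k x / 2 ^ k)) \<longlonglongrightarrow> X k x / 2 ^ k"
      proof (rule AE_I2, rule tendsto_eventually)
        fix x
        obtain N where "X k x / 2 ^ k - c - 1 \<le> real N" using real_arch_simple by blast
        then show "\<forall>\<^sub>F n in sequentially. min (c + 1 + real n) (X k x / 2 ^ k) = X k x / 2 ^ k"
          by (intro eventually_sequentiallyI[of N]) (auto simp: min_def)
      qed
      show "AE x in M. norm (min (c + 1 + real n) (X k x / 2 ^ k)) \<le> \<bar>c + 1\<bar> + X k x / 2 ^ k" for n
      proof (rule AE_I2)
        fix x
        have "0 \<le> X k x / 2 ^ k" using nonneg by simp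
        then show "norm (min (c + 1 + real n) (X k x / 2 ^ k)) \<le> \<bar>c + 1\<bar> + X k x / 2 ^ k"
          by (simp add: min_def abs_if)
      qed
    qed (use int in auto)
    then have "expectation (\<lambda>x. X k x / 2 ^ k) \<le> g"
      by (rule LIMSEQ_le_const2) (use le in auto)
    then show ?thesis by simp
  qed
  then have "c \<le> g" by (intro LIMSEQ_le_const2[OF lim]) auto
  with g show ?thesis by simp
qed

end

section \<open>Counts of the marked Poisson process\<close>

text \<open>The exponential moment at parameter one of the Poisson law with mean \<open>m\<close>,
  for the bound on a maximum over many staircases.\<close>

lemma sum_exp_poisson: "(\<lambda>k. exp (real k) * (exp (- m) * m ^ k / fact k)) sums exp (m * (exp 1 - 1))"
proof -
  define e where "e = exp (1::real)"
  have e: "exp (real k) = e ^ k" for k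
    using exp_of_nat_mult[of k "1::real"] by (simp add: e_def)
  have "(\<lambda>k. exp (- m) * ((m * e) ^ k /\<^sub>R fact k)) sums (exp (- m) * exp (m * e))"
    by (intro sums_mult exp_converges)
  moreover have "(\<lambda>k. exp (- m) * ((m * e) ^ k /\<^sub>R fact k)) = (\<lambda>k. exp (real k) * (exp (- m) * m ^ k / fact k))"
    unfolding e by (rule ext) (simp add: power_mult_distrib divide_inverse)
  moreover have "exp (- m) * exp (m * e) = exp (m * (exp 1 - 1))"
    using exp_add[of "-m" "m * e"] by (simp add: algebra_simps e_def)
  ultimately show ?thesis by (simp only:)
qed

lemma sum_mean_poisson: "(\<lambda>k. real k * (exp (- m) * m ^ k / fact k)) sums (m::real)"
proof -
  have "(\<lambda>k. exp (- m) * m * (m ^ k /\<^sub>R fact k)) sums (exp (- m) * m * exp m)"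
    by (intro sums_mult exp_converges)
  moreover have "(\<lambda>k. exp (- m) * m * (m ^ k /\<^sub>R fact k)) = (\<lambda>k. real (Suc k) * (exp (- m) * m ^ Suc k / fact (Suc k)))"
    by (rule ext) (simp add: divide_inverse)
  moreover have "exp (- m) * m * exp m = m" by (simp add: exp_minus)
  ultimately have "(\<lambda>k. real (Suc k) * (exp (- m) * m ^ Suc k / fact (Suc k))) sums m"
    by (simp only:)
  then show ?thesis by (subst (asm) sums_Suc_iff) simp
qed

locale marked_poisson_env =
  fixes M :: "'w measure" and Q :: "'w \<Rightarrow> ((real \<times> real) \<times> real) set" and D :: "real measure"
  assumes D: "real_distribution D"
    and D_pos: "measure D {..0} = 0"
    and Q: "marked_poisson M Q D"
begin

abbreviation "mu \<equiv> (lborel :: (real \<times> real) measure) \<Otimes>\<^sub>M D"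

text \<open>As \<open>card\<close> of an infinite set is 0, a count says something about the points
  only together with almost sure finiteness.\<close>

definition "cnt B \<omega> = card (Q \<omega> \<inter> B)"

sublocale D: real_distribution D by (rule D)

lemma poisson_process_Q: "poisson_process M Q mu"
  using Q by (simp add: marked_poisson_def)

sublocale prob_space M
  using poisson_process_Q by (simp add: poisson_process_def)

lemma sets_mu: "sets mu = sets borel"
proof -
  have "sets mu = sets (borel \<Otimes>\<^sub>M borel)"
    by (intro sets_pair_measure_cong) auto
  then show ?thesis unfolding borel_prod .
qed

lemma emeasure_mu_Times:
  assumes "A \<in> sets borel" "S \<in> sets borel"
  shows "emeasure mu (A \<times> S) = emeasure lborel A * emeasure D S"
  using assms by (intro D.emeasure_pair_measure_Times) auto

lemma cnt_measurable:
  assumes "B \<in> sets borel" "emeasure mu B < \<infinity>"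
  shows "cnt B \<in> measurable M (count_space UNIV)"
  using poisson_process_Q assms unfolding poisson_process_def sets_mu cnt_def[abs_def] by blast

lemma cnt_AE_finite:
  assumes "B \<in> sets borel" "emeasure mu B < \<infinity>"
  shows "AE \<omega> in M. finite (Q \<omega> \<inter> B)"
  using poisson_process_Q assms unfolding poisson_process_def sets_mu by blast

lemma prob_cnt:
  assumes "B \<in> sets borel" "emeasure mu B < \<infinity>"
  shows "prob {\<omega>\<in>space M. cnt B \<omega> = k} = exp (- measure mu B) * measure mu B ^ k / fact k"
  using poisson_process_Q assms unfolding poisson_process_def sets_mu cnt_def by blast

lemma indep_cnt:
  fixes I :: "nat set"
  assumes "finite I" "\<And>i. i \<in> I \<Longrightarrow> B i \<in> sets borel" "\<And>i. i \<in> I \<Longrightarrow> emeasure mu (B i) < \<infinity>"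
    and "disjoint_family_on B I"
  shows "indep_vars (\<lambda>_. count_space UNIV) (\<lambda>i. cnt (B i)) I"
proof -
  have "\<And>(I::nat set) B. finite I \<Longrightarrow> (\<forall>i\<in>I. B i \<in> sets mu \<and> emeasure mu (B i) < \<infinity>) \<Longrightarrow>
      disjoint_family_on B I \<Longrightarrow> indep_vars (\<lambda>_. count_space UNIV) (\<lambda>i \<omega>. card (Q \<omega> \<inter> B i)) I"
    using poisson_process_Q by (simp add: poisson_process_def)
  note ind = this[of I B]
  show ?thesis
    unfolding cnt_def[abs_def] by (rule ind) (use assms in \<open>simp_all only: sets_mu, blast\<close>)
qed

lemma nn_integral_cnt:
  fixes f :: "nat \<Rightarrow> ennreal"
  assumes B: "B \<in> sets borel" "emeasure mu B < \<infinity>"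
  shows "(\<integral>\<^sup>+\<omega>. f (cnt B \<omega>) \<partial>M) = (\<Sum>k. f k * ennreal (exp (- measure mu B) * measure mu B ^ k / fact k))"
proof -
  note [measurable] = cnt_measurable[OF B]
  have "f (cnt B \<omega>) = (\<Sum>k. f k * indicator {\<omega>\<in>space M. cnt B \<omega> = k} \<omega>)" if "\<omega> \<in> space M" for \<omega>
    using that by (subst suminf_finite[where N = "{cnt B \<omega>}"]) auto
  then have "(\<integral>\<^sup>+\<omega>. f (cnt B \<omega>) \<partial>M) = (\<integral>\<^sup>+\<omega>. (\<Sum>k. f k * indicator {\<omega>\<in>space M. cnt B \<omega> = k} \<omega>) \<partial>M)"
    by (intro nn_integral_cong) auto
  also have "\<dots> = (\<Sum>k. \<integral>\<^sup>+\<omega>. f k * indicator {\<omega>\<in>space M. cnt B \<omega> = k} \<omega> \<partial>M)"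
    by (intro nn_integral_suminf) measurable
  also have "\<dots> = (\<Sum>k. f k * ennreal (exp (- measure mu B) * measure mu B ^ k / fact k))"
    by (simp add: nn_integral_cmult emeasure_eq_measure prob_cnt[OF B])
  finally show ?thesis .
qed

lemma nn_integral_exp_cnt:
  assumes B: "B \<in> sets borel" "emeasure mu B < \<infinity>"
  shows "(\<integral>\<^sup>+\<omega>. ennreal (exp (real (cnt B \<omega>))) \<partial>M) = ennreal (exp (measure mu B * (exp 1 - 1)))"
proof -
  have "ennreal (exp (real k)) * ennreal (exp (- measure mu B) * measure mu B ^ k / fact k)
      = ennreal (exp (real k) * (exp (- measure mu B) * measure mu B ^ k / fact k))" for k
    by (rule ennreal_mult[symmetric]) auto
  then show ?thesis
    unfolding nn_integral_cnt[OF B, of "\<lambda>k. ennreal (exp (real k))"]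
    by (simp only:) (rule suminf_ennreal_eq[OF _ sum_exp_poisson], simp)
qed

lemma nn_integral_real_cnt:
  assumes B: "B \<in> sets borel" "emeasure mu B < \<infinity>"
  shows "(\<integral>\<^sup>+\<omega>. ennreal (real (cnt B \<omega>)) \<partial>M) = ennreal (measure mu B)"
proof -
  have "ennreal (real k) * ennreal (exp (- measure mu B) * measure mu B ^ k / fact k)
      = ennreal (real k * (exp (- measure mu B) * measure mu B ^ k / fact k))" for k
    by (rule ennreal_mult[symmetric]) auto
  then show ?thesis
    unfolding nn_integral_cnt[OF B, of "\<lambda>k. ennreal (real k)"]
    by (simp only:) (rule suminf_ennreal_eq[OF _ sum_mean_poisson], simp)
qed

lemma AE_no_points_null:
  assumes B: "B \<in> sets borel" "emeasure mu B = 0"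
  shows "AE \<omega> in M. Q \<omega> \<inter> B = {}"
proof -
  have fin: "emeasure mu B < \<infinity>" using B by simp
  note [measurable] = cnt_measurable[OF B(1) fin]
  have "prob {\<omega>\<in>space M. cnt B \<omega> = 0} = 1"
    using prob_cnt[OF B(1) fin, of 0] B by (simp add: measure_def)
  then have "AE \<omega> in M. cnt B \<omega> = 0"
    by (subst (asm) prob_Collect_eq_1) auto
  with cnt_AE_finite[OF B(1) fin] show ?thesis
    by eventually_elim (auto simp: cnt_def)
qed

text \<open>The bound is quadratic in the mass, so the sum over \<open>2 ^ n\<close> thin strips of
  mass of order \<open>1 / 2 ^ n\<close> still tends to zero.\<close>

lemma prob_cnt_ge_2:
  assumes B: "B \<in> sets borel" "emeasure mu B < \<infinity>"
  shows "prob {\<omega>\<in>space M. 2 \<le> cnt B \<omega>} \<le> (measure mu B)\<^sup>2"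
proof -
  note [measurable] = cnt_measurable[OF B]
  define m where "m = measure mu B"
  have "{\<omega>\<in>space M. 2 \<le> cnt B \<omega>} = space M - ({\<omega>\<in>space M. cnt B \<omega> = 0} \<union> {\<omega>\<in>space M. cnt B \<omega> = 1})"
    by auto
  then have "prob {\<omega>\<in>space M. 2 \<le> cnt B \<omega>} = 1 - prob ({\<omega>\<in>space M. cnt B \<omega> = 0} \<union> {\<omega>\<in>space M. cnt B \<omega> = 1})"
    by (simp add: prob_compl)
  also have "prob ({\<omega>\<in>space M. cnt B \<omega> = 0} \<union> {\<omega>\<in>space M. cnt B \<omega> = 1}) = exp (- m) + exp (- m) * m"
    by (subst finite_measure_Union) (auto simp: prob_cnt[OF B] m_def)
  also have "1 - (exp (- m) + exp (- m) * m) \<le> 1 - (1 - m) * (1 + m)"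
    using mult_right_mono[OF exp_ge_add_one_self[of "- m"], of "1 + m"]
    by (simp add: m_def algebra_simps)
  finally show ?thesis by (simp add: m_def power2_eq_square algebra_simps)
qed

lemma prob_occupied_nat:
  fixes I :: "nat set"
  assumes I: "finite I" "\<And>i. i \<in> I \<Longrightarrow> B i \<in> sets borel" "\<And>i. i \<in> I \<Longrightarrow> emeasure mu (B i) < \<infinity>"
    and disj: "disjoint_family_on B I" and A: "A \<subseteq> I"
  shows "prob {\<omega>\<in>space M. {i\<in>I. cnt (B i) \<omega> \<noteq> 0} = A} =
    (\<Prod>i\<in>I. if i \<in> A then 1 - exp (- measure mu (B i)) else exp (- measure mu (B i)))"
proof (cases "I = {}")
  case False
  define S where "S i = (if i \<in> A then - {0::nat} else {0})" for i
  have "{\<omega>\<in>space M. {i\<in>I. cnt (B i) \<omega> \<noteq> 0} = A} = (\<Inter>i\<in>I. cnt (B i) -` S i \<inter> space M)"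
    using A False by (auto simp: S_def split: if_splits)
  also have "prob \<dots> = (\<Prod>i\<in>I. prob (cnt (B i) -` S i \<inter> space M))"
    by (rule indep_varsD_finite[OF indep_cnt[OF I disj] False I(1)]) auto
  also have "\<dots> = (\<Prod>i\<in>I. if i \<in> A then 1 - exp (- measure mu (B i)) else exp (- measure mu (B i)))"
  proof (rule prod.cong[OF refl])
    fix i assume i: "i \<in> I"
    note [measurable] = cnt_measurable[OF I(2)[OF i] I(3)[OF i]]
    have 0: "prob {\<omega>\<in>space M. cnt (B i) \<omega> = 0} = exp (- measure mu (B i))"
      using prob_cnt[OF I(2)[OF i] I(3)[OF i], of 0] by simp
    have "prob {\<omega>\<in>space M. cnt (B i) \<omega> \<noteq> 0} = 1 - prob {\<omega>\<in>space M. cnt (B i) \<omega> = 0}"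
      by (rule prob_neg) measurable
    moreover have "cnt (B i) -` (- {0}) \<inter> space M = {\<omega>\<in>space M. cnt (B i) \<omega> \<noteq> 0}"
      "cnt (B i) -` {0} \<inter> space M = {\<omega>\<in>space M. cnt (B i) \<omega> = 0}" by auto
    ultimately show "prob (cnt (B i) -` S i \<inter> space M)
        = (if i \<in> A then 1 - exp (- measure mu (B i)) else exp (- measure mu (B i)))"
      using 0 by (simp add: S_def)
  qed
  finally show ?thesis .
qed (use A in \<open>auto simp: prob_space\<close>)

text \<open>The Poisson property indexes its disjoint sets by natural numbers, while cells are
  indexed by tuples; \<open>to_nat\<close> carries the product formula over.\<close>

lemma prob_occupied:
  fixes I :: "'i::countable set"
  assumes I: "finite I" "\<And>i. i \<in> I \<Longrightarrow> B i \<in> sets borel" "\<And>i. i \<in> I \<Longrightarrow> emeasure mu (B i) < \<infinity>"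
    and disj: "disjoint_family_on B I" and A: "A \<subseteq> I"
  shows "prob {\<omega>\<in>space M. {i\<in>I. cnt (B i) \<omega> \<noteq> 0} = A} =
    (\<Prod>i\<in>I. if i \<in> A then 1 - exp (- measure mu (B i)) else exp (- measure mu (B i)))"
proof -
  have inj: "inj_on to_nat I" by simp
  have "({i\<in>to_nat ` I. cnt (B (from_nat i)) \<omega> \<noteq> 0} = to_nat ` A) \<longleftrightarrow> ({i\<in>I. cnt (B i) \<omega> \<noteq> 0} = A)" for \<omega>
  proof -
    have "{i\<in>to_nat ` I. cnt (B (from_nat i)) \<omega> \<noteq> 0} = to_nat ` {i\<in>I. cnt (B i) \<omega> \<noteq> 0}" by auto
    then show ?thesis by (simp add: inj_image_eq_iff)
  qed
  then have "prob {\<omega>\<in>space M. {i\<in>I. cnt (B i) \<omega> \<noteq> 0} = A} =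
    prob {\<omega>\<in>space M. {i\<in>to_nat ` I. cnt (B (from_nat i)) \<omega> \<noteq> 0} = to_nat ` A}" by simp
  also have "\<dots> = (\<Prod>i\<in>to_nat ` I. if i \<in> to_nat ` A then 1 - exp (- measure mu (B (from_nat i)))
       else exp (- measure mu (B (from_nat i))))"
    using I disj A by (intro prob_occupied_nat) (auto simp: disjoint_family_on_def)
  also have "\<dots> = (\<Prod>i\<in>I. if i \<in> A then 1 - exp (- measure mu (B i)) else exp (- measure mu (B i)))"
    by (subst prod.reindex[OF inj]) (auto simp: inj_image_mem_iff intro!: prod.cong)
  finally show ?thesis .
qed

end

section \<open>Dyadic discretisation\<close>

text \<open>The index may exceed \<open>2 ^ n\<close>: the pieces then continue beyond
  \<open>b\<close>, which is how the pieces of mesh \<open>1 / 2 ^ n\<close> based on the unit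
  interval also cover large weights.\<close>

definition sub :: "real \<Rightarrow> real \<Rightarrow> nat \<Rightarrow> nat \<Rightarrow> real set" where
  "sub a b n i = {a + real i * ((b - a) / 2 ^ n) <.. a + (real i + 1) * ((b - a) / 2 ^ n)}"

text \<open>Ceiling minus one instead of a floor, because the pieces are closed on the right. Points
  at or left of \<open>a\<close> are sent to 0 by \<open>nat\<close>, hence the condition
  \<open>a < x\<close> where the index has to be faithful.\<close>

definition sub_index :: "real \<Rightarrow> real \<Rightarrow> nat \<Rightarrow> real \<Rightarrow> nat" where
  "sub_index a b n x = nat (\<lceil>(x - a) / (b - a) * 2 ^ n\<rceil> - 1)"

lemma mem_sub_iff:
  assumes "a < b"
  shows "x \<in> sub a b n i \<longleftrightarrow> \<lceil>(x - a) / (b - a) * 2 ^ n\<rceil> = int i + 1"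
proof -
  define h where "h = (b - a) / 2 ^ n"
  have h: "0 < h" using assms by (simp add: h_def)
  have "(x - a) / (b - a) * 2 ^ n = (x - a) / h" using assms by (simp add: h_def field_simps)
  then show ?thesis
    using h by (simp add: sub_def ceiling_eq_iff h_def[symmetric] pos_less_divide_eq pos_divide_le_eq)
      (simp add: algebra_simps)
qed

lemma sub_index_iff:
  assumes "a < b" "a < x"
  shows "x \<in> sub a b n i \<longleftrightarrow> i = sub_index a b n x"
proof -
  have "0 < (x - a) / (b - a) * 2 ^ n" using assms by simp
  then have "1 \<le> \<lceil>(x - a) / (b - a) * 2 ^ n\<rceil>" by linarith
  then show ?thesis using mem_sub_iff[OF assms(1)] by (auto simp: sub_index_def)
qed

lemma sub_index_less:
  assumes "a < b" "x - a \<le> (b - a) * c" "0 < c" and m: "c * 2 ^ n = real m"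
  shows "sub_index a b n x < m"
proof -
  have "0 < m" using m assms(3) by (metis mult_pos_pos of_nat_0_less_iff zero_less_numeral zero_less_power)
  have "(x - a) / (b - a) \<le> c" using assms by (simp add: field_simps)
  then have "(x - a) / (b - a) * 2 ^ n \<le> real m" unfolding m[symmetric] by (intro mult_right_mono) auto
  then have "\<lceil>(x - a) / (b - a) * 2 ^ n\<rceil> \<le> int m" by (simp add: ceiling_le_iff)
  with \<open>0 < m\<close> show ?thesis by (simp add: sub_index_def)
qed

lemma sub_index_mono:
  assumes "a < b" "x \<le> y"
  shows "sub_index a b n x \<le> sub_index a b n y"
  unfolding sub_index_def using assms
  by (intro nat_mono diff_right_mono ceiling_mono mult_right_mono divide_right_mono) auto

lemma eventually_sub_index_neq:
  assumes "a < b" "a < x" "a < y" "x \<noteq> y"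
  shows "\<forall>\<^sub>F n in sequentially. sub_index a b n x \<noteq> sub_index a b n y"
proof -
  obtain N where N: "(b - a) / \<bar>x - y\<bar> < 2 ^ N" using real_arch_pow[of 2] by auto
  show ?thesis
  proof (rule eventually_sequentiallyI[of N], rule notI)
    fix n assume n: "N \<le> n" and eq: "sub_index a b n x = sub_index a b n y"
    define h where "h = (b - a) / 2 ^ n"
    have "x \<in> sub a b n (sub_index a b n x)" "y \<in> sub a b n (sub_index a b n x)"
      using assms eq by (simp_all add: sub_index_iff)
    then have "\<bar>x - y\<bar> < h" by (auto simp: sub_def h_def[symmetric] algebra_simps)
    moreover have "h \<le> (b - a) / 2 ^ N"
      unfolding h_def using n assms(1) by (intro divide_left_mono) (auto simp: power_increasing)
    moreover have "(b - a) / 2 ^ N < \<bar>x - y\<bar>" using N assms by (simp add: field_simps)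
    ultimately show False by simp
  qed
qed

lemma sub_subset:
  assumes "a < b" "i < 2 ^ n"
  shows "sub a b n i \<subseteq> {a<..b}"
proof -
  have "real (Suc i) \<le> real (2 ^ n)" using assms(2) by (simp only: of_nat_le_iff Suc_le_eq)
  then have "(real i + 1) * ((b - a) / 2 ^ n) \<le> 2 ^ n * ((b - a) / 2 ^ n)"
    using assms(1) by (intro mult_right_mono) auto
  moreover have "0 \<le> real i * ((b - a) / 2 ^ n)" using assms(1) by simp
  ultimately show ?thesis by (auto simp: sub_def)
qed

lemma sub_borel[measurable]: "sub a b n i \<in> sets borel"
  by (simp add: sub_def)

lemma emeasure_lborel_sub:
  assumes "a < b"
  shows "emeasure lborel (sub a b n i) = ennreal ((b - a) / 2 ^ n)"
proof -
  define h where "h = (b - a) / 2 ^ n"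
  have "0 \<le> h" using assms by (simp add: h_def)
  then have "emeasure lborel (sub a b n i) = ennreal (a + (real i + 1) * h - (a + real i * h))"
    unfolding sub_def h_def[symmetric] by (intro emeasure_lborel_Ioc) (simp add: distrib_right)
  then show ?thesis by (simp add: distrib_right h_def[symmetric])
qed

definition cell :: "real \<times> real \<Rightarrow> real \<times> real \<Rightarrow> nat \<Rightarrow> nat \<times> nat \<times> nat \<Rightarrow> ((real \<times> real) \<times> real) set" where
  "cell p q n = (\<lambda>(i, j, k). (sub (fst p) (fst q) n i \<times> sub (snd p) (snd q) n j) \<times> sub 0 1 n k)"

text \<open>With \<open>4 ^ n\<close> weight pieces of length \<open>1 / 2 ^ n\<close> the range of
  weights grows to \<open>2 ^ n\<close> while the mesh shrinks.\<close>

definition grid :: "nat \<Rightarrow> (nat \<times> nat \<times> nat) set" where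
  "grid n = {..<2 ^ n} \<times> {..<2 ^ n} \<times> {..<4 ^ n}"

definition occ :: "real \<times> real \<Rightarrow> real \<times> real \<Rightarrow> nat \<Rightarrow> ((real \<times> real) \<times> real) set \<Rightarrow> (nat \<times> nat \<times> nat) set" where
  "occ p q n S = {t \<in> grid n. card (S \<inter> cell p q n t) \<noteq> 0}"

text \<open>Each occupied cell is replaced by its index and its weight is rounded down. For points in general
  position and a fine grid this preserves the order relation between the points in both directions.\<close>

definition lpp_grid :: "nat \<Rightarrow> (nat \<times> nat \<times> nat) set \<Rightarrow> real" where
  "lpp_grid n T = lpp ((\<lambda>(i, j, k). ((real i, real j), real k / 2 ^ n)) ` T) (-1, -1) (2 ^ n, 2 ^ n)"

lemma finite_grid: "finite (grid n)"
  by (simp add: grid_def)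

lemma cell_subset_rect:
  assumes "fst p < fst q" "snd p < snd q" "t \<in> grid n"
  shows "cell p q n t \<subseteq> rect p q"
  using assms sub_subset[of "fst p" "fst q"] sub_subset[of "snd p" "snd q"]
  by (force simp: cell_def rect_def in_rect_def grid_def)

lemma disjoint_cells:
  assumes "fst p < fst q" "snd p < snd q"
  shows "disjoint_family_on (cell p q n) T"
  unfolding disjoint_family_on_def cell_def using assms by (auto simp: mem_sub_iff)

text \<open>Distinct coordinates let a fine grid put the points into distinct rows and distinct
  columns. Positive weights ensure that each point lies in some cell, since the weight pieces start
  to the right of 0.\<close>

definition general_position :: "((real \<times> real) \<times> real) set \<Rightarrow> bool" where
  "general_position S \<longleftrightarrow> finite S \<and> inj_on (fst \<circ> fst) S \<and> inj_on (snd \<circ> fst) S \<and> (\<forall>z\<in>S. 0 < snd z)"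

lemma lpp_grid_tendsto:
  assumes pq: "fst p < fst q" "snd p < snd q" and gp: "general_position (Q \<inter> rect p q)"
  shows "(\<lambda>n. lpp_grid n (occ p q n Q)) \<longlonglongrightarrow> lpp Q p q"
proof -
  define S where "S = Q \<inter> rect p q"
  have fin: "finite S" and injx: "inj_on (fst \<circ> fst) S" and injy: "inj_on (snd \<circ> fst) S"
    and pos: "\<And>z. z \<in> S \<Longrightarrow> 0 < snd z"
    using gp by (auto simp: general_position_def S_def)
  have SR: "fst p < fst (fst z)" "fst (fst z) \<le> fst q" "snd p < snd (fst z)" "snd (fst z) \<le> snd q"
    if "z \<in> S" for z using that by (auto simp: S_def rect_def in_rect_def)
  define X where "X n z = sub_index (fst p) (fst q) n (fst (fst z))" for n and z :: "(real \<times> real) \<times> real"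
  define Y where "Y n z = sub_index (snd p) (snd q) n (snd (fst z))" for n and z :: "(real \<times> real) \<times> real"
  define W where "W n z = sub_index 0 1 n (snd z)" for n and z :: "(real \<times> real) \<times> real"
  define emb where "emb n = (\<lambda>(i, j, k). ((real i, real j), real k / 2 ^ n))" for n :: nat
  define F where "F n z = emb n (X n z, Y n z, W n z)" for n z
  have "\<forall>z\<in>S. \<forall>\<^sub>F n in sequentially. snd z \<le> 2 ^ n"
  proof
    fix z assume "z \<in> S"
    obtain N where "snd z < 2 ^ N" using real_arch_pow[of 2 "snd z"] by auto
    then show "\<forall>\<^sub>F n in sequentially. snd z \<le> 2 ^ n"
      by (intro eventually_sequentiallyI[of N])
         (meson less_imp_le one_le_numeral order_trans power_increasing)
  qed
  moreover have "\<forall>z\<in>S. \<forall>z'\<in>S - {z}. \<forall>\<^sub>F n in sequentially. X n z \<noteq> X n z' \<and> Y n z \<noteq> Y n z'"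
  proof (intro ballI)
    fix z z' assume "z \<in> S" "z' \<in> S - {z}"
    then have "fst (fst z) \<noteq> fst (fst z')" "snd (fst z) \<noteq> snd (fst z')"
      using injx injy by (auto simp: inj_on_def)
    then show "\<forall>\<^sub>F n in sequentially. X n z \<noteq> X n z' \<and> Y n z \<noteq> Y n z'"
      unfolding X_def Y_def using \<open>z \<in> S\<close> \<open>z' \<in> S - {z}\<close> pq SR
      by (intro eventually_conj eventually_sub_index_neq) auto
  qed
  ultimately have "\<forall>\<^sub>F n in sequentially. (\<forall>z\<in>S. snd z \<le> 2 ^ n) \<and>
      (\<forall>z\<in>S. \<forall>z'\<in>S - {z}. X n z \<noteq> X n z' \<and> Y n z \<noteq> Y n z')"
    using fin by (intro eventually_conj) (simp_all add: eventually_ball_finite_distrib)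
  \<comment> \<open>Once the grid separates the points, only the weights are distorted: each point
    changes by at most one mesh width, and a chain has at most \<open>card S\<close> points.\<close>
  then have ev: "\<forall>\<^sub>F n in sequentially. \<bar>lpp_grid n (occ p q n Q) - lpp Q p q\<bar> \<le> real (card S) * (1 / 2 ^ n)"
  proof eventually_elim
    case (elim n)
    have W_less: "W n z < 4 ^ n" if "z \<in> S" for z
      unfolding W_def using elim that
      by (intro sub_index_less[where c = "2 ^ n"]) (auto simp flip: power_mult_distrib)
    have XY_less: "X n z < 2 ^ n" "Y n z < 2 ^ n" if "z \<in> S" for z
      unfolding X_def Y_def using SR[OF that] pq
      by (intro sub_index_less[where c = 1]; simp)+
    have cell_iff: "z \<in> cell p q n t \<longleftrightarrow> t = (X n z, Y n z, W n z)" if "z \<in> S" for z t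
      using SR[OF that] pos[OF that] pq
      by (cases z; cases t) (auto simp: cell_def X_def Y_def W_def sub_index_iff)
    have "occ p q n Q = (\<lambda>z. (X n z, Y n z, W n z)) ` S"
    proof (intro equalityI subsetI)
      fix t assume "t \<in> occ p q n Q"
      then have t: "t \<in> grid n" "card (Q \<inter> cell p q n t) \<noteq> 0" by (auto simp: occ_def)
      then have "Q \<inter> cell p q n t \<noteq> {}" by (metis card.empty)
      then obtain z where "z \<in> Q" "z \<in> cell p q n t" by blast
      moreover from this have "z \<in> S" using cell_subset_rect[OF pq t(1)] by (auto simp: S_def)
      ultimately show "t \<in> (\<lambda>z. (X n z, Y n z, W n z)) ` S" using cell_iff by blast
    next
      fix t assume "t \<in> (\<lambda>z. (X n z, Y n z, W n z)) ` S"
      then obtain z where z: "z \<in> S" "t = (X n z, Y n z, W n z)" by blast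
      then have t: "t \<in> grid n" using W_less XY_less by (simp add: grid_def)
      have "Q \<inter> cell p q n t \<subseteq> S" using cell_subset_rect[OF pq t] by (auto simp: S_def)
      then have "finite (Q \<inter> cell p q n t)" using fin finite_subset by blast
      moreover have "z \<in> Q \<inter> cell p q n t" using z cell_iff[OF z(1)] by (auto simp: S_def)
      ultimately have "card (Q \<inter> cell p q n t) \<noteq> 0" by (metis card_0_eq empty_iff)
      with t show "t \<in> occ p q n Q" by (simp add: occ_def)
    qed
    then have grid_eq: "lpp_grid n (occ p q n Q) = lpp (F n ` S) (-1, -1) (2 ^ n, 2 ^ n)"
      by (simp add: lpp_grid_def image_image F_def emb_def)
    have X_less: "real (X n z) \<le> 2 ^ n" "real (Y n z) \<le> 2 ^ n" if "z \<in> S" for z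
      using XY_less[OF that] by (metis less_imp_le of_nat_le_iff of_nat_numeral of_nat_power)+
    \<comment> \<open>The corner \<open>(-1, -1)\<close> leaves room for the index 0, which a
      rectangle open on the left at 0 would exclude.\<close>
    have FR: "F n ` S \<inter> rect (-1, -1) (2 ^ n, 2 ^ n) = F n ` S"
      using X_less by (auto simp: rect_def in_rect_def F_def emb_def)
    have neq: "X n z \<noteq> X n z'" "Y n z \<noteq> Y n z'" if "z \<in> S" "z' \<in> S" "z \<noteq> z'" for z z'
      using elim that by auto
    have injF: "inj_on (F n) S"
    proof (rule inj_onI, rule ccontr)
      fix z z' assume "z \<in> S" "z' \<in> S" "F n z = F n z'" "z \<noteq> z'"
      then show False using neq(1)[of z z'] by (simp add: F_def emb_def)
    qed
    have mono: "X n z \<le> X n z'" if "fst (fst z) \<le> fst (fst z')" for z z'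
      unfolding X_def using that pq by (intro sub_index_mono)
    have monoY: "Y n z \<le> Y n z'" if "snd (fst z) \<le> snd (fst z')" for z z'
      unfolding Y_def using that pq by (intro sub_index_mono)
    \<comment> \<open>Monotone indices give one direction. For the converse, distinct points have
      distinct indices in both coordinates, so the order of the indices determines that of the
      coordinates.\<close>
    have lt: "lt2 (fst (F n z)) (fst (F n z')) \<longleftrightarrow> lt2 (fst z) (fst z')" if z: "z \<in> S" "z' \<in> S" for z z'
    proof (cases "z = z'")
      case False
      note ne = neq[OF z False]
      have ne': "fst z \<noteq> fst z'" using ne by (auto simp: X_def)
      show ?thesis
        using ne ne' mono[of z z'] mono[of z' z] monoY[of z z'] monoY[of z' z]
          linear[of "fst (fst z)" "fst (fst z')"] linear[of "snd (fst z)" "snd (fst z')"]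
        by (auto simp: lt2_def F_def emb_def)
    qed (simp add: lt2_irrefl)
    have Wb: "real (W n z) / 2 ^ n \<le> snd z" "snd z \<le> real (W n z) / 2 ^ n + 1 / 2 ^ n" if "z \<in> S" for z
    proof -
      have "snd z \<in> sub 0 1 n (W n z)" unfolding W_def using pos[OF that] by (simp add: sub_index_iff)
      then show "real (W n z) / 2 ^ n \<le> snd z" "snd z \<le> real (W n z) / 2 ^ n + 1 / 2 ^ n"
        by (auto simp: sub_def add_divide_distrib)
    qed
    have "lpp Q p q \<le> lpp (F n ` S) (-1, -1) (2 ^ n, 2 ^ n) + real (card (Q \<inter> rect p q)) * (1 / 2 ^ n)"
    proof (rule lpp_compare[where f = "F n"], unfold FR S_def[symmetric])
      fix z assume "z \<in> S"
      then show "snd z \<le> snd (F n z) + 1 / 2 ^ n"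
        using Wb(2) by (simp add: F_def emb_def)
    qed (use fin lt in auto)
    moreover have "lpp (F n ` S) (-1, -1) (2 ^ n, 2 ^ n) \<le> lpp Q p q + real (card (F n ` S \<inter> rect (-1, -1) (2 ^ n, 2 ^ n))) * (1 / 2 ^ n)"
    proof (rule lpp_compare[where f = "inv_into S (F n)"], unfold FR S_def[symmetric])
      fix e assume "e \<in> F n ` S"
      then obtain z where z: "z \<in> S" "e = F n z" by blast
      then show "snd e \<le> snd (inv_into S (F n) e) + 1 / 2 ^ n"
        using Wb(1)[OF z(1)] by (simp add: injF) (simp add: F_def emb_def add_increasing2)
    next
      fix e e' assume "e \<in> F n ` S" "e' \<in> F n ` S" "lt2 (fst e) (fst e')"
      then show "lt2 (fst (inv_into S (F n) e)) (fst (inv_into S (F n) e'))"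
        using lt by (auto simp: injF)
    qed (use fin injF in auto)
    moreover have "card (F n ` S) = card S" using injF by (rule card_image)
    ultimately show ?case unfolding grid_eq FR S_def[symmetric] by (simp add: abs_le_iff)
  qed
  have "(\<lambda>n. lpp_grid n (occ p q n Q) - lpp Q p q) \<longlonglongrightarrow> 0"
  proof (rule Lim_null_comparison)
    show "\<forall>\<^sub>F n in sequentially. norm (lpp_grid n (occ p q n Q) - lpp Q p q) \<le> real (card S) * (1 / 2) ^ n"
      using ev by eventually_elim (simp add: power_one_over)
    show "(\<lambda>n. real (card S) * (1 / 2) ^ n) \<longlonglongrightarrow> 0"
      by (intro tendsto_mult_right_zero LIMSEQ_power_zero) auto
  qed
  then show ?thesis by (simp add: LIM_zero_iff)
qed

lemma borel_Times_borel:
  fixes A :: "'a::second_countable_topology set" and B :: "'b::second_countable_topology set"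
  assumes "A \<in> sets borel" "B \<in> sets borel"
  shows "A \<times> B \<in> sets borel"
  using pair_measureI[OF assms] unfolding borel_prod .

lemma emeasure_lborel_Times:
  fixes A B :: "real set"
  assumes "A \<in> sets borel" "B \<in> sets borel"
  shows "emeasure lborel (A \<times> B) = emeasure lborel A * emeasure lborel B"
  unfolding lborel_prod[symmetric] using assms by (intro lborel.emeasure_pair_measure_Times) auto

definition area :: "real \<times> real \<Rightarrow> real \<times> real \<Rightarrow> real" where
  "area p q = (fst q - fst p) * (snd q - snd p)"

lemma rect_eq_Times: "rect p q = ({fst p<..fst q} \<times> {snd p<..snd q}) \<times> UNIV"
  by (auto simp: rect_def in_rect_def)

lemma cell_borel: "cell p q n t \<in> sets borel"
  by (cases t) (auto simp: cell_def intro!: borel_Times_borel)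

lemma rect_borel: "rect p q \<in> sets borel"
  unfolding rect_eq_Times by (intro borel_Times_borel) auto

section \<open>Masses of cells and general position of the points\<close>

context marked_poisson_env begin

lemma emeasure_cell:
  assumes "fst p < fst q" "snd p < snd q"
  shows "emeasure mu (cell p q n (i, j, k)) = ennreal (area p q / 4 ^ n * measure D (sub 0 1 n k))"
proof -
  have "emeasure mu (cell p q n (i, j, k)) =
      ennreal ((fst q - fst p) / 2 ^ n) * ennreal ((snd q - snd p) / 2 ^ n) * ennreal (measure D (sub 0 1 n k))"
    unfolding cell_def prod.case
    by (subst emeasure_mu_Times)
       (auto intro: borel_Times_borel simp: assms emeasure_lborel_Times emeasure_lborel_sub D.emeasure_eq_measure)
  also have "\<dots> = ennreal ((fst q - fst p) / 2 ^ n * ((snd q - snd p) / 2 ^ n) * measure D (sub 0 1 n k))"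
    using assms by (simp add: ennreal_mult del: times_divide_eq_left times_divide_eq_right)
  also have "(fst q - fst p) / 2 ^ n * ((snd q - snd p) / 2 ^ n) = area p q / 4 ^ n"
    by (simp add: area_def flip: power_mult_distrib)
  finally show ?thesis .
qed

lemma emeasure_rect:
  assumes "fst p \<le> fst q" "snd p \<le> snd q"
  shows "emeasure mu (rect p q) = ennreal (area p q)"
  unfolding rect_eq_Times using assms D.emeasure_space_1
  by (subst emeasure_mu_Times) (auto intro: borel_Times_borel simp: emeasure_lborel_Times area_def ennreal_mult)

text \<open>Points with the same value of \<open>f\<close> share a strip at every level
  \<open>n\<close>. Some strip of level \<open>n\<close> holds two points with probability at most
  \<open>2 ^ n\<close> times the square of \<open>c / 2 ^ n\<close>, which tends to zero.\<close>

lemma AE_inj_on: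
  fixes f :: "(real \<times> real) \<times> real \<Rightarrow> 'b" and B :: "nat \<Rightarrow> nat \<Rightarrow> ((real \<times> real) \<times> real) set"
  assumes B: "\<And>n i. B n i \<in> sets borel" "\<And>n i. emeasure mu (B n i) \<le> ennreal (c / 2 ^ n)"
    and c: "0 \<le> c" and h: "\<And>n z. z \<in> R \<Longrightarrow> z \<in> B n (h n (f z)) \<and> h n (f z) < 2 ^ n"
  shows "AE \<omega> in M. inj_on f (Q \<omega> \<inter> R)"
proof -
  have fin: "emeasure mu (B n i) < \<infinity>" for n i
    using B(2)[of n i] by (simp add: le_less_trans)
  have mB: "measure mu (B n i) \<le> c / 2 ^ n" for n i
    using enn2real_mono[OF B(2)[of n i]] c by (simp add: measure_def)
  have [measurable]: "cnt (B n i) \<in> measurable M (count_space UNIV)" for n i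
    using cnt_measurable[OF B(1) fin] .
  define N where "N n = {\<omega>\<in>space M. \<exists>i<2 ^ n. 2 \<le> cnt (B n i) \<omega>}" for n :: nat
  have N_sets[measurable]: "N n \<in> sets M" for n unfolding N_def by measurable
  have "prob (N n) \<le> c\<^sup>2 / 2 ^ n" for n
  proof -
    have "N n = (\<Union>i<2 ^ n. {\<omega>\<in>space M. 2 \<le> cnt (B n i) \<omega>})" by (auto simp: N_def)
    also have "prob \<dots> \<le> (\<Sum>i<2 ^ n. prob {\<omega>\<in>space M. 2 \<le> cnt (B n i) \<omega>})"
      by (rule finite_measure_subadditive_finite) auto
    also have "\<dots> \<le> (\<Sum>i<(2::nat) ^ n. (c / 2 ^ n)\<^sup>2)"
    proof (rule sum_mono)
      fix i show "prob {\<omega>\<in>space M. 2 \<le> cnt (B n i) \<omega>} \<le> (c / 2 ^ n)\<^sup>2"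
        using prob_cnt_ge_2[OF B(1) fin, of n i] power_mono[OF mB[of n i], of 2] by simp
    qed
    also have "\<dots> = c\<^sup>2 / 2 ^ n" by (simp add: power2_eq_square)
    finally show ?thesis .
  qed
  moreover have "prob (\<Inter>n. N n) \<le> prob (N n)" for n by (rule finite_measure_mono) auto
  ultimately have le: "prob (\<Inter>n. N n) \<le> c\<^sup>2 * (1 / 2) ^ n" for n
    by (metis (no_types, lifting) order_trans power_one_over divide_inverse inverse_eq_divide)
  have "(\<lambda>n. c\<^sup>2 * (1 / 2) ^ n) \<longlonglongrightarrow> 0"
    by (intro tendsto_mult_right_zero LIMSEQ_power_zero) auto
  then have "prob (\<Inter>n. N n) \<le> 0" by (rule LIMSEQ_le_const) (use le in auto)
  then have "prob (\<Inter>n. N n) = 0" by (simp add: measure_le_0_iff)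
  then have "AE \<omega> in M. \<omega> \<notin> (\<Inter>n. N n)"
    by (intro AE_not_in) (auto simp: null_sets_def emeasure_eq_measure)
  moreover have "AE \<omega> in M. \<forall>n i. finite (Q \<omega> \<inter> B n i)"
    using cnt_AE_finite[OF B(1) fin] by (simp add: AE_all_countable)
  ultimately show ?thesis using AE_space
  proof eventually_elim
    case (elim \<omega>)
    then obtain n where n: "\<omega> \<notin> N n" by auto
    show ?case
    proof (rule inj_onI, rule ccontr)
      fix z z' assume z: "z \<in> Q \<omega> \<inter> R" "z' \<in> Q \<omega> \<inter> R" "f z = f z'" "z \<noteq> z'"
      let ?C = "Q \<omega> \<inter> B n (h n (f z))"
      have "{z, z'} \<subseteq> ?C" using z h[of z n] h[of z' n] by auto
      then have "card {z, z'} \<le> card ?C" using elim by (intro card_mono) auto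
      then have "2 \<le> cnt (B n (h n (f z))) \<omega>" using z by (simp add: cnt_def)
      with n elim h[of z n] z show False by (auto simp: N_def)
    qed
  qed
qed

lemma AE_general_position:
  assumes pq: "fst p < fst q" "snd p < snd q"
  shows "AE \<omega> in M. general_position (Q \<omega> \<inter> rect p q)"
proof -
  have "AE \<omega> in M. finite (Q \<omega> \<inter> rect p q)"
    using pq by (intro cnt_AE_finite rect_borel) (simp add: emeasure_rect)
  \<comment> \<open>Infinite Lebesgue mass times zero is zero in the extended reals, so the whole
    half space of nonpositive weights is null at once.\<close>
  moreover have "AE \<omega> in M. Q \<omega> \<inter> UNIV \<times> {..0} = {}"
    using D_pos by (intro AE_no_points_null borel_Times_borel)
      (auto simp: emeasure_mu_Times D.emeasure_eq_measure)
  moreover have "AE \<omega> in M. inj_on (fst \<circ> fst) (Q \<omega> \<inter> rect p q)"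
  proof (rule AE_inj_on[where B = "\<lambda>n i. (sub (fst p) (fst q) n i \<times> {snd p<..snd q}) \<times> UNIV"
        and h = "sub_index (fst p) (fst q)" and c = "area p q"])
    fix n i
    show "emeasure mu ((sub (fst p) (fst q) n i \<times> {snd p<..snd q}) \<times> UNIV) \<le> ennreal (area p q / 2 ^ n)"
      using pq D.emeasure_space_1
      by (subst emeasure_mu_Times)
         (auto intro: borel_Times_borel simp: emeasure_lborel_Times emeasure_lborel_sub area_def simp flip: ennreal_mult)
  next
    fix n and z :: "(real \<times> real) \<times> real" assume "z \<in> rect p q"
    then show "z \<in> (sub (fst p) (fst q) n (sub_index (fst p) (fst q) n ((fst \<circ> fst) z)) \<times> {snd p<..snd q}) \<times> UNIV
      \<and> sub_index (fst p) (fst q) n ((fst \<circ> fst) z) < 2 ^ n"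
      using pq by (auto simp: rect_eq_Times sub_index_iff mem_Times_iff intro!: sub_index_less[where c = 1])
  qed (use pq in \<open>auto intro!: borel_Times_borel simp: area_def\<close>)
  moreover have "AE \<omega> in M. inj_on (snd \<circ> fst) (Q \<omega> \<inter> rect p q)"
  proof (rule AE_inj_on[where B = "\<lambda>n i. ({fst p<..fst q} \<times> sub (snd p) (snd q) n i) \<times> UNIV"
        and h = "sub_index (snd p) (snd q)" and c = "area p q"])
    fix n i
    show "emeasure mu (({fst p<..fst q} \<times> sub (snd p) (snd q) n i) \<times> UNIV) \<le> ennreal (area p q / 2 ^ n)"
      using pq D.emeasure_space_1
      by (subst emeasure_mu_Times)
         (auto intro: borel_Times_borel simp: emeasure_lborel_Times emeasure_lborel_sub area_def simp flip: ennreal_mult)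
  next
    fix n and z :: "(real \<times> real) \<times> real" assume "z \<in> rect p q"
    then show "z \<in> ({fst p<..fst q} \<times> sub (snd p) (snd q) n (sub_index (snd p) (snd q) n ((snd \<circ> fst) z))) \<times> UNIV
      \<and> sub_index (snd p) (snd q) n ((snd \<circ> fst) z) < 2 ^ n"
      using pq by (auto simp: rect_eq_Times sub_index_iff mem_Times_iff intro!: sub_index_less[where c = 1])
  qed (use pq in \<open>auto intro!: borel_Times_borel simp: area_def\<close>)
  ultimately show ?thesis
    by eventually_elim (auto simp: general_position_def mem_Times_iff not_le[symmetric] disjoint_iff)
qed

end

section \<open>The law of the passage time\<close>

context prob_space begin

lemma expectation_finite_range:
  fixes h :: "'b \<Rightarrow> real"
  assumes X: "X \<in> measurable M (count_space A)" and A: "finite A"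
  shows "expectation (\<lambda>x. h (X x)) = (\<Sum>a\<in>A. h a * prob {x\<in>space M. X x = a})"
proof -
  have sets: "{x\<in>space M. X x = a} \<in> sets M" if "a \<in> A" for a
    using measurable_sets[OF X, of "{a}"] that by (simp add: vimage_def Collect_conj_eq Int_commute)
  have "expectation (\<lambda>x. h (X x)) = expectation (\<lambda>x. \<Sum>a\<in>A. h a * indicator {x\<in>space M. X x = a} x)"
  proof (rule Bochner_Integration.integral_cong[OF refl])
    fix x assume x: "x \<in> space M"
    then have "X x \<in> A" using measurable_space[OF X] by simp
    with A x show "h (X x) = (\<Sum>a\<in>A. h a * indicator {x\<in>space M. X x = a} x)"
      by (subst sum.remove[of A "X x"]) (auto simp: indicator_def intro!: sum.neutral)
  qed
  also have "\<dots> = (\<Sum>a\<in>A. h a * prob {x\<in>space M. X x = a})"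
    using sets by (subst Bochner_Integration.integral_sum) (auto intro!: integrable_mult_right integrable_indicator_iff[THEN iffD2] simp: emeasure_eq_measure)
  finally show ?thesis .
qed

end

context marked_poisson_env begin

definition lpp_approx :: "real \<times> real \<Rightarrow> real \<times> real \<Rightarrow> nat \<Rightarrow> 'w \<Rightarrow> real" where
  "lpp_approx p q n \<omega> = lpp_grid n (occ p q n (Q \<omega>))"

text \<open>The passage time itself need not be measurable with respect to the possibly incomplete \<open>M\<close>,
  so we work with an almost surely equal version.\<close>

definition lpp_version :: "real \<times> real \<Rightarrow> real \<times> real \<Rightarrow> 'w \<Rightarrow> real" where
  "lpp_version p q \<omega> = max 0 (lim (\<lambda>n. lpp_approx p q n \<omega>))"

text \<open>The area of the rectangle is the only geometric parameter here, which yields at once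
  translation invariance and invariance under \<open>(x, y) \<mapsto> (c x, y / c)\<close>.\<close>

definition occ_prob :: "nat \<Rightarrow> real \<Rightarrow> (nat \<times> nat \<times> nat) set \<Rightarrow> real" where
  "occ_prob n a T = (\<Prod>t\<in>grid n. let m = a / 4 ^ n * measure D (sub 0 1 n (snd (snd t)))
     in if t \<in> T then 1 - exp (- m) else exp (- m))"

lemma occ_eq_cnt: "occ p q n (Q \<omega>) = {t\<in>grid n. cnt (cell p q n t) \<omega> \<noteq> 0}"
  by (simp add: occ_def cnt_def)

lemma measure_cell:
  assumes "fst p < fst q" "snd p < snd q"
  shows "measure mu (cell p q n t) = area p q / 4 ^ n * measure D (sub 0 1 n (snd (snd t)))"
    and "emeasure mu (cell p q n t) < \<infinity>"
  using emeasure_cell[OF assms, of n "fst t" "fst (snd t)" "snd (snd t)"] assms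
  by (simp_all add: measure_def area_def)

lemma occ_measurable:
  assumes "fst p < fst q" "snd p < snd q"
  shows "(\<lambda>\<omega>. occ p q n (Q \<omega>)) \<in> measurable M (count_space (Pow (grid n)))"
proof (subst measurable_count_space_eq2, safe)
  note [measurable] = cnt_measurable[OF cell_borel measure_cell(2)[OF assms]]
  fix T assume T: "T \<subseteq> grid n"
  have "(\<lambda>\<omega>. occ p q n (Q \<omega>)) -` {T} \<inter> space M
      = {\<omega>\<in>space M. \<forall>t\<in>grid n. cnt (cell p q n t) \<omega> \<noteq> 0 \<longleftrightarrow> t \<in> T}"
    using T by (auto simp: occ_eq_cnt)
  also have "\<dots> \<in> sets M" using finite_grid by measurable
  finally show "(\<lambda>\<omega>. occ p q n (Q \<omega>)) -` {T} \<inter> space M \<in> sets M" .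
qed (auto simp: finite_grid occ_def)

lemma prob_occ:
  assumes "fst p < fst q" "snd p < snd q" and T: "T \<subseteq> grid n"
  shows "prob {\<omega>\<in>space M. occ p q n (Q \<omega>) = T} = occ_prob n (area p q) T"
proof -
  have "prob {\<omega>\<in>space M. {t\<in>grid n. cnt (cell p q n t) \<omega> \<noteq> 0} = T} = (\<Prod>t\<in>grid n.
      if t \<in> T then 1 - exp (- measure mu (cell p q n t)) else exp (- measure mu (cell p q n t)))"
    by (rule prob_occupied[OF finite_grid cell_borel measure_cell(2)[OF assms(1,2)] disjoint_cells[OF assms(1,2)] T])
  then show ?thesis
    unfolding occ_eq_cnt occ_prob_def Let_def measure_cell(1)[OF assms(1,2)] .
qed

text \<open>Cells of both grids, tagged by a Boolean, form one disjoint family, so a single use of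
  the product formula yields the independence of the two occupation patterns.\<close>

lemma prob_occ_occ:
  assumes pq: "fst p < fst q" "snd p < snd q" and pq': "fst p' < fst q'" "snd p' < snd q'"
    and disj: "rect p q \<inter> rect p' q' = {}" and T: "T \<subseteq> grid n" "T' \<subseteq> grid n"
  shows "prob {\<omega>\<in>space M. occ p q n (Q \<omega>) = T \<and> occ p' q' n (Q \<omega>) = T'}
     = occ_prob n (area p q) T * occ_prob n (area p' q') T'"
proof -
  define B where "B = (\<lambda>(b, t). if b then cell p q n t else cell p' q' n t)"
  define I where "I = (UNIV :: bool set) \<times> grid n"
  define A where "A = ({True} \<times> T) \<union> ({False} \<times> T')"
  have B: "B i \<in> sets borel" "emeasure mu (B i) < \<infinity>" for i
    using measure_cell(2)[OF pq] measure_cell(2)[OF pq'] by (auto simp: B_def cell_borel split: prod.split)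
  have dj: "disjoint_family_on B I"
    unfolding disjoint_family_on_def
  proof (intro ballI impI)
    fix i j assume ij: "i \<in> I" "j \<in> I" "i \<noteq> j"
    obtain b t c s where eq: "i = (b, t)" "j = (c, s)" by (metis surj_pair)
    then have ts: "t \<in> grid n" "s \<in> grid n" using ij by (auto simp: I_def)
    have disj': "cell p q n u \<inter> cell p' q' n v = {}" if "u \<in> grid n" "v \<in> grid n" for u v
      using disj cell_subset_rect[OF pq that(1)] cell_subset_rect[OF pq' that(2)] by blast
    show "B i \<inter> B j = {}"
    proof (cases "b = c")
      case True
      then show ?thesis
        using ij ts disjoint_cells[OF pq, of n "grid n"] disjoint_cells[OF pq', of n "grid n"]
        by (auto simp: eq B_def disjoint_family_on_def)
    next
      case False
      then show ?thesis
        using disj'[OF ts] disj'[OF ts(2,1)] by (cases b) (auto simp: eq B_def)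
    qed
  qed
  have "{i\<in>I. cnt (B i) \<omega> \<noteq> 0} = A \<longleftrightarrow> occ p q n (Q \<omega>) = T \<and> occ p' q' n (Q \<omega>) = T'" for \<omega>
  proof -
    have "{i\<in>I. cnt (B i) \<omega> \<noteq> 0} = ({True} \<times> occ p q n (Q \<omega>)) \<union> ({False} \<times> occ p' q' n (Q \<omega>))"
      by (auto simp: I_def B_def occ_eq_cnt split: if_splits)
    moreover have "({True} \<times> a \<union> {False} \<times> b = {True} \<times> c \<union> {False} \<times> d) \<longleftrightarrow> a = c \<and> b = d"
      for a b c d :: "(nat \<times> nat \<times> nat) set" by blast
    ultimately show ?thesis by (simp only: A_def)
  qed
  then have "prob {\<omega>\<in>space M. occ p q n (Q \<omega>) = T \<and> occ p' q' n (Q \<omega>) = T'}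
      = prob {\<omega>\<in>space M. {i\<in>I. cnt (B i) \<omega> \<noteq> 0} = A}" by simp
  also have "\<dots> = (\<Prod>i\<in>I. if i \<in> A then 1 - exp (- measure mu (B i)) else exp (- measure mu (B i)))"
    using B dj T by (intro prob_occupied) (auto simp: I_def A_def finite_grid)
  also have "\<dots> = (\<Prod>b\<in>UNIV. \<Prod>t\<in>grid n. if (b, t) \<in> A then 1 - exp (- measure mu (B (b, t)))
       else exp (- measure mu (B (b, t))))"
    unfolding I_def by (simp add: prod.cartesian_product)
  also have "\<dots> = occ_prob n (area p q) T * occ_prob n (area p' q') T'"
    unfolding occ_prob_def Let_def measure_cell(1)[OF pq, symmetric] measure_cell(1)[OF pq', symmetric]
    by (simp add: UNIV_bool B_def A_def mult.commute cong: if_cong)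
  finally show ?thesis .
qed

lemma lpp_approx_measurable:
  assumes "fst p < fst q" "snd p < snd q"
  shows "lpp_approx p q n \<in> borel_measurable M"
  unfolding lpp_approx_def[abs_def]
  by (rule measurable_compose[OF occ_measurable[OF assms]]) simp

lemma lpp_version_measurable:
  assumes "fst p < fst q" "snd p < snd q"
  shows "lpp_version p q \<in> borel_measurable M"
  using lpp_approx_measurable[OF assms] unfolding lpp_version_def[abs_def] by measurable

text \<open>Valid at every \<omega>, even where the approximations diverge and \<open>lim\<close> is
  arbitrary; the maximum with 0 in the definition secures this for arguments that require pointwise
  nonnegativity.\<close>

lemma lpp_version_nonneg: "0 \<le> lpp_version p q \<omega>"
  by (simp add: lpp_version_def)

lemma AE_lpp_approx_tendsto:
  assumes "fst p < fst q" "snd p < snd q"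
  shows "AE \<omega> in M. lpp_version p q \<omega> = lpp (Q \<omega>) p q \<and> (\<lambda>n. lpp_approx p q n \<omega>) \<longlonglongrightarrow> lpp_version p q \<omega>"
  using AE_general_position[OF assms]
proof eventually_elim
  case (elim \<omega>)
  have l: "(\<lambda>n. lpp_approx p q n \<omega>) \<longlonglongrightarrow> lpp (Q \<omega>) p q"
    unfolding lpp_approx_def using assms elim by (rule lpp_grid_tendsto)
  have "0 \<le> lpp (Q \<omega>) p q" using elim by (intro lpp_nonneg) (simp add: general_position_def)
  then have "lpp_version p q \<omega> = lpp (Q \<omega>) p q" using limI[OF l] by (simp add: lpp_version_def)
  with l show ?case by simp
qed

lemma AE_lpp_version:
  assumes "fst p < fst q" "snd p < snd q"
  shows "AE \<omega> in M. lpp_version p q \<omega> = lpp (Q \<omega>) p q"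
  using AE_lpp_approx_tendsto[OF assms] by eventually_elim simp

lemma expectation_lpp_approx:
  fixes \<phi> :: "real \<Rightarrow> real"
  assumes "fst p < fst q" "snd p < snd q"
  shows "expectation (\<lambda>\<omega>. \<phi> (lpp_approx p q n \<omega>)) = (\<Sum>T\<in>Pow (grid n). \<phi> (lpp_grid n T) * occ_prob n (area p q) T)"
  unfolding lpp_approx_def
  using expectation_finite_range[OF occ_measurable[OF assms], of n "\<lambda>T. \<phi> (lpp_grid n T)"]
  by (simp add: finite_grid prob_occ[OF assms])

lemma expectation_lpp_approx_mult:
  fixes \<phi> \<psi> :: "real \<Rightarrow> real"
  assumes pq: "fst p < fst q" "snd p < snd q" and pq': "fst p' < fst q'" "snd p' < snd q'"
    and disj: "rect p q \<inter> rect p' q' = {}"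
  shows "expectation (\<lambda>\<omega>. \<phi> (lpp_approx p q n \<omega>) * \<psi> (lpp_approx p' q' n \<omega>))
     = expectation (\<lambda>\<omega>. \<phi> (lpp_approx p q n \<omega>)) * expectation (\<lambda>\<omega>. \<psi> (lpp_approx p' q' n \<omega>))"
proof -
  have m: "(\<lambda>\<omega>. (occ p q n (Q \<omega>), occ p' q' n (Q \<omega>))) \<in> measurable M (count_space (Pow (grid n) \<times> Pow (grid n)))"
    using measurable_Pair[OF occ_measurable[OF pq, of n] occ_measurable[OF pq', of n]] finite_grid
    by (simp add: pair_measure_countable countable_finite)
  have "expectation (\<lambda>\<omega>. \<phi> (lpp_approx p q n \<omega>) * \<psi> (lpp_approx p' q' n \<omega>)) =
     (\<Sum>(T, T')\<in>Pow (grid n) \<times> Pow (grid n). \<phi> (lpp_grid n T) * \<psi> (lpp_grid n T') *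
       prob {\<omega>\<in>space M. (occ p q n (Q \<omega>), occ p' q' n (Q \<omega>)) = (T, T')})"
    unfolding lpp_approx_def
    using expectation_finite_range[OF m, of "\<lambda>(T, T'). \<phi> (lpp_grid n T) * \<psi> (lpp_grid n T')"]
    by (simp add: finite_grid case_prod_beta prod_eq_iff)
  also have "\<dots> = (\<Sum>(T, T')\<in>Pow (grid n) \<times> Pow (grid n). (\<phi> (lpp_grid n T) * occ_prob n (area p q) T) *
       (\<psi> (lpp_grid n T') * occ_prob n (area p' q') T'))"
    using prob_occ_occ[OF pq pq' disj] by (intro sum.cong) (auto simp: mult_ac)
  also have "\<dots> = expectation (\<lambda>\<omega>. \<phi> (lpp_approx p q n \<omega>)) * expectation (\<lambda>\<omega>. \<psi> (lpp_approx p' q' n \<omega>))"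
    unfolding expectation_lpp_approx[OF pq] expectation_lpp_approx[OF pq'] sum_product
    by (simp add: sum.cartesian_product)
  finally show ?thesis .
qed

section \<open>From the grid to the law of the passage time\<close>

lemma expectation_lpp_approx_tendsto:
  fixes \<phi> :: "real \<Rightarrow> real"
  assumes pq: "fst p < fst q" "snd p < snd q"
    and \<phi>: "continuous_on UNIV \<phi>" "\<And>x. \<bar>\<phi> x\<bar> \<le> b"
  shows "(\<lambda>n. expectation (\<lambda>\<omega>. \<phi> (lpp_approx p q n \<omega>))) \<longlonglongrightarrow> expectation (\<lambda>\<omega>. \<phi> (lpp_version p q \<omega>))"
proof (rule integral_dominated_convergence[where w = "\<lambda>_. b"])
  note [measurable] = lpp_approx_measurable[OF pq] lpp_version_measurable[OF pq] borel_measurable_continuous_onI[OF \<phi>(1)]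
  show "(\<lambda>\<omega>. \<phi> (lpp_version p q \<omega>)) \<in> borel_measurable M" by measurable
  show "(\<lambda>\<omega>. \<phi> (lpp_approx p q n \<omega>)) \<in> borel_measurable M" for n by measurable
  show "AE \<omega> in M. (\<lambda>n. \<phi> (lpp_approx p q n \<omega>)) \<longlonglongrightarrow> \<phi> (lpp_version p q \<omega>)"
    using AE_lpp_approx_tendsto[OF pq]
    by eventually_elim (auto intro: continuous_on_tendsto_compose[OF \<phi>(1)])
qed (use \<phi>(2) in auto)

text \<open>Both sides are limits of the same finite sums, because the occupation probabilities
  depend on the rectangle only through its area.\<close>

lemma expectation_lpp_version_cong:
  fixes \<phi> :: "real \<Rightarrow> real"
  assumes pq: "fst p < fst q" "snd p < snd q" and pq': "fst p' < fst q'" "snd p' < snd q'"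
    and "area p q = area p' q'" and \<phi>: "continuous_on UNIV \<phi>" "\<And>x. \<bar>\<phi> x\<bar> \<le> b"
  shows "expectation (\<lambda>\<omega>. \<phi> (lpp_version p q \<omega>)) = expectation (\<lambda>\<omega>. \<phi> (lpp_version p' q' \<omega>))"
  using expectation_lpp_approx_tendsto[OF pq \<phi>] expectation_lpp_approx_tendsto[OF pq' \<phi>]
  unfolding expectation_lpp_approx[OF pq] expectation_lpp_approx[OF pq'] assms(5)
  by (rule LIMSEQ_unique)

lemma expectation_lpp_version_mult:
  fixes \<phi> \<psi> :: "real \<Rightarrow> real"
  assumes pq: "fst p < fst q" "snd p < snd q" and pq': "fst p' < fst q'" "snd p' < snd q'"
    and disj: "rect p q \<inter> rect p' q' = {}"
    and \<phi>: "continuous_on UNIV \<phi>" "\<And>x. \<bar>\<phi> x\<bar> \<le> b" and \<psi>: "continuous_on UNIV \<psi>" "\<And>x. \<bar>\<psi> x\<bar> \<le> b"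
  shows "expectation (\<lambda>\<omega>. \<phi> (lpp_version p q \<omega>) * \<psi> (lpp_version p' q' \<omega>))
     = expectation (\<lambda>\<omega>. \<phi> (lpp_version p q \<omega>)) * expectation (\<lambda>\<omega>. \<psi> (lpp_version p' q' \<omega>))"
proof (rule LIMSEQ_unique)
  show "(\<lambda>n. expectation (\<lambda>\<omega>. \<phi> (lpp_approx p q n \<omega>) * \<psi> (lpp_approx p' q' n \<omega>)))
    \<longlonglongrightarrow> expectation (\<lambda>\<omega>. \<phi> (lpp_version p q \<omega>)) * expectation (\<lambda>\<omega>. \<psi> (lpp_version p' q' \<omega>))"
    unfolding expectation_lpp_approx_mult[OF pq pq' disj]
    by (intro tendsto_mult expectation_lpp_approx_tendsto[OF pq \<phi>] expectation_lpp_approx_tendsto[OF pq' \<psi>])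
  note [measurable] = lpp_approx_measurable[OF pq] lpp_version_measurable[OF pq]
    lpp_approx_measurable[OF pq'] lpp_version_measurable[OF pq']
    borel_measurable_continuous_onI[OF \<phi>(1)] borel_measurable_continuous_onI[OF \<psi>(1)]
  show "(\<lambda>n. expectation (\<lambda>\<omega>. \<phi> (lpp_approx p q n \<omega>) * \<psi> (lpp_approx p' q' n \<omega>)))
    \<longlonglongrightarrow> expectation (\<lambda>\<omega>. \<phi> (lpp_version p q \<omega>) * \<psi> (lpp_version p' q' \<omega>))"
  proof (rule integral_dominated_convergence[where w = "\<lambda>_. b * b"])
    show "(\<lambda>\<omega>. \<phi> (lpp_version p q \<omega>) * \<psi> (lpp_version p' q' \<omega>)) \<in> borel_measurable M" by measurable
    show "(\<lambda>\<omega>. \<phi> (lpp_approx p q n \<omega>) * \<psi> (lpp_approx p' q' n \<omega>)) \<in> borel_measurable M" for n by measurable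
    show "AE \<omega> in M. (\<lambda>n. \<phi> (lpp_approx p q n \<omega>) * \<psi> (lpp_approx p' q' n \<omega>))
       \<longlonglongrightarrow> \<phi> (lpp_version p q \<omega>) * \<psi> (lpp_version p' q' \<omega>)"
      using AE_lpp_approx_tendsto[OF pq] AE_lpp_approx_tendsto[OF pq']
      by eventually_elim
         (auto intro!: tendsto_mult intro: continuous_on_tendsto_compose[OF \<phi>(1)] continuous_on_tendsto_compose[OF \<psi>(1)])
    show "AE \<omega> in M. norm (\<phi> (lpp_approx p q n \<omega>) * \<psi> (lpp_approx p' q' n \<omega>)) \<le> b * b" for n
      using \<phi>(2) \<psi>(2) by (auto simp: abs_mult intro!: AE_I2 mult_mono order_trans[OF abs_ge_zero])
  qed simp
qed

text \<open>Stated for extended values because it must precede integrability, which general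
  rectangles inherit from squares through it. The identity is unbounded, so bounded continuous
  truncations increase to it and monotone convergence concludes.\<close>

lemma nn_integral_lpp_version_cong:
  assumes pq: "fst p < fst q" "snd p < snd q" and pq': "fst p' < fst q'" "snd p' < snd q'"
    and area: "area p q = area p' q'"
  shows "(\<integral>\<^sup>+\<omega>. ennreal (lpp_version p q \<omega>) \<partial>M) = (\<integral>\<^sup>+\<omega>. ennreal (lpp_version p' q' \<omega>) \<partial>M)"
proof -
  have *: "(\<integral>\<^sup>+\<omega>. ennreal (lpp_version p q \<omega>) \<partial>M)
     = (SUP n. ennreal (expectation (\<lambda>\<omega>. max 0 (min (real n) (lpp_version p q \<omega>)))))"
    if pq: "fst p < fst q" "snd p < snd q" for p q
  proof -
    note [measurable] = lpp_version_measurable[OF pq]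
    have "ennreal (lpp_version p q \<omega>) = (SUP n. ennreal (max 0 (min (real n) (lpp_version p q \<omega>))))" for \<omega>
    proof (rule antisym)
      obtain N where "lpp_version p q \<omega> \<le> real N" using real_arch_simple by blast
      then have "ennreal (lpp_version p q \<omega>) = ennreal (max 0 (min (real N) (lpp_version p q \<omega>)))"
        using lpp_version_nonneg by simp
      then show "ennreal (lpp_version p q \<omega>) \<le> (SUP n. ennreal (max 0 (min (real n) (lpp_version p q \<omega>))))"
        by (metis SUP_upper UNIV_I)
      show "(SUP n. ennreal (max 0 (min (real n) (lpp_version p q \<omega>)))) \<le> ennreal (lpp_version p q \<omega>)"
        using lpp_version_nonneg by (intro SUP_least ennreal_leI) auto
    qed
    then have "(\<integral>\<^sup>+\<omega>. ennreal (lpp_version p q \<omega>) \<partial>M)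
       = (\<integral>\<^sup>+\<omega>. (SUP n. ennreal (max 0 (min (real n) (lpp_version p q \<omega>)))) \<partial>M)" by simp
    also have "\<dots> = (SUP n. \<integral>\<^sup>+\<omega>. ennreal (max 0 (min (real n) (lpp_version p q \<omega>))) \<partial>M)"
      by (intro nn_integral_monotone_convergence_SUP) (auto simp: incseq_def le_fun_def intro!: ennreal_leI max.mono min.mono)
    also have "\<dots> = (SUP n. ennreal (expectation (\<lambda>\<omega>. max 0 (min (real n) (lpp_version p q \<omega>)))))"
    proof (intro SUP_cong refl nn_integral_eq_integral)
      fix n show "integrable M (\<lambda>\<omega>. max 0 (min (real n) (lpp_version p q \<omega>)))"
        by (rule integrable_const_bound[where B = "real n"]) auto
    qed auto
    finally show ?thesis .
  qed
  have "expectation (\<lambda>\<omega>. max 0 (min (real n) (lpp_version p q \<omega>)))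
      = expectation (\<lambda>\<omega>. max 0 (min (real n) (lpp_version p' q' \<omega>)))" for n
    by (rule expectation_lpp_version_cong[OF pq pq' area, where b = "real n"])
       (auto intro!: continuous_intros)
  then show ?thesis by (simp add: *[OF pq] *[OF pq'])
qed

end

section \<open>Bound on the mean\<close>

definition square :: "real \<Rightarrow> nat \<Rightarrow> nat \<Rightarrow> (real \<times> real) set" where
  "square h i j = {real i * h<..(real i + 1) * h} \<times> {real j * h<..(real j + 1) * h}"

fun staircase :: "real \<Rightarrow> nat \<Rightarrow> nat \<Rightarrow> bool list \<Rightarrow> (real \<times> real) set" where
  "staircase h i j [] = square h i j"
| "staircase h i j (b # bs) = square h i j \<union> (if b then staircase h (Suc i) j bs else staircase h i (Suc j) bs)"

lemma square_borel: "square h i j \<in> sets borel"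
  unfolding square_def by (intro borel_Times_borel) auto

lemma emeasure_square:
  assumes "0 \<le> h"
  shows "emeasure lborel (square h i j) = ennreal (h\<^sup>2)"
proof -
  have le: "real k * h \<le> (real k + 1) * h" for k using assms by (simp add: distrib_right)
  have d: "(real k + 1) * h - real k * h = h" for k by (simp add: distrib_right)
  show ?thesis
    unfolding square_def
    by (simp add: emeasure_lborel_Times emeasure_lborel_Ioc[OF le] d power2_eq_square assms flip: ennreal_mult)
qed

lemma staircase_borel: "staircase h i j bs \<in> sets borel"
  by (induction h i j bs rule: staircase.induct) (auto simp: square_borel)

lemma emeasure_staircase:
  assumes "0 \<le> h"
  shows "emeasure lborel (staircase h i j bs) \<le> ennreal ((real (length bs) + 1) * h\<^sup>2)"
proof (induction bs arbitrary: i j)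
  case (Cons b bs)
  have "emeasure lborel (staircase h i j (b # bs)) \<le> emeasure lborel (square h i j) +
      emeasure lborel (if b then staircase h (Suc i) j bs else staircase h i (Suc j) bs)"
    unfolding staircase.simps by (rule emeasure_subadditive) (auto simp: square_borel staircase_borel)
  also have "\<dots> \<le> ennreal (h\<^sup>2) + ennreal ((real (length bs) + 1) * h\<^sup>2)"
    using Cons by (intro add_mono) (auto simp: emeasure_square assms)
  also have "\<dots> = ennreal ((real (length (b # bs)) + 1) * h\<^sup>2)"
    by (subst ennreal_plus[symmetric]) (auto simp: algebra_simps)
  finally show ?case .
qed (simp add: emeasure_square assms)

text \<open>If some point of the chain lies strictly above the corner square in its column, no point can lie
  strictly to the right of it in its row; so one step up or one step right loses only the corner.\<close>

lemma staircase_cover: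
  fixes c r :: "real \<times> real \<Rightarrow> nat"
  assumes "\<And>x. x \<in> C \<Longrightarrow> x \<in> square h (c x) (r x)"
    and "\<And>x y. \<lbrakk>x \<in> C; y \<in> C\<rbrakk> \<Longrightarrow> c x \<le> c y \<and> r x \<le> r y \<or> c y \<le> c x \<and> r y \<le> r x"
    and "\<And>x. x \<in> C \<Longrightarrow> i \<le> c x \<and> j \<le> r x \<and> c x + r x \<le> i + j + n"
  shows "\<exists>bs. length bs = n \<and> C \<subseteq> staircase h i j bs"
  using assms
proof (induction n arbitrary: i j C)
  case 0
  have "c x = i \<and> r x = j" if "x \<in> C" for x using "0.prems"(3)[OF that] by simp
  with "0.prems"(1) show ?case by (intro exI[of _ "[]"]) auto
next
  case (Suc n)
  define C' where "C' = {x \<in> C. \<not> (c x = i \<and> r x = j)}"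
  have sq: "C \<subseteq> square h i j \<union> C'" using Suc.prems(1) by (auto simp: C'_def)
  show ?case
  proof (cases "\<exists>y\<in>C'. c y = i")
    case True
    then obtain y where y: "y \<in> C" "c y = i" "r y \<noteq> j" by (auto simp: C'_def)
    have "\<exists>bs. length bs = n \<and> C' \<subseteq> staircase h i (Suc j) bs"
    proof (rule Suc.IH)
      fix x assume x: "x \<in> C'"
      then show "i \<le> c x \<and> Suc j \<le> r x \<and> c x + r x \<le> i + Suc j + n"
        using Suc.prems(3)[of x] Suc.prems(2)[of x y] Suc.prems(3)[of y] y by (auto simp: C'_def)
    qed (use Suc.prems(1,2) in \<open>auto simp: C'_def\<close>)
    then obtain bs where "length bs = n" "C' \<subseteq> staircase h i (Suc j) bs" by blast
    with sq show ?thesis by (intro exI[of _ "False # bs"]) auto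
  next
    case False
    have "\<exists>bs. length bs = n \<and> C' \<subseteq> staircase h (Suc i) j bs"
    proof (rule Suc.IH)
      fix x assume x: "x \<in> C'"
      then show "Suc i \<le> c x \<and> j \<le> r x \<and> c x + r x \<le> Suc i + j + n"
      proof -
        have "c x \<noteq> i" using False x by blast
        moreover have "x \<in> C" using x by (simp add: C'_def)
        ultimately show ?thesis using Suc.prems(3)[of x] by simp
      qed
    qed (use Suc.prems(1,2) in \<open>auto simp: C'_def\<close>)
    then obtain bs where "length bs = n" "C' \<subseteq> staircase h (Suc i) j bs" by blast
    with sq show ?thesis by (intro exI[of _ "True # bs"]) auto
  qed
qed

lemma sorted_wrt_comparable:
  "\<lbrakk>sorted_wrt R xs; x \<in> set xs; y \<in> set xs\<rbrakk> \<Longrightarrow> R x y \<or> R y x \<or> x = y"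
  by (induction xs) auto

lemma chain_staircase:
  fixes K :: nat
  assumes xs: "xs \<in> chains Q (0, 0) (s, s)" and s: "0 < s" and K: "0 < K"
    and fin: "\<And>bs. length bs = 2 * K - 2 \<Longrightarrow> finite (Q \<inter> staircase (s / K) 0 0 bs \<times> {u<..})"
  shows "\<exists>bs. length bs = 2 * K - 2 \<and>
    length (filter (\<lambda>z. u < snd z) xs) \<le> card (Q \<inter> staircase (s / K) 0 0 bs \<times> {u<..})"
proof -
  define h where "h = s / K"
  have h: "0 < h" using s K by (simp add: h_def)
  define ix where "ix x = nat (\<lceil>x / h\<rceil> - 1)" for x :: real
  have ix: "real (ix x) * h < x" "x \<le> (real (ix x) + 1) * h" "ix x \<le> K - 1" if "0 < x" "x \<le> s" for x
  proof -
    have 0: "0 < x / h" using that h by simp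
    then have 1: "1 \<le> \<lceil>x / h\<rceil>" by linarith
    then have eq: "real (ix x) = of_int \<lceil>x / h\<rceil> - 1" by (simp add: ix_def)
    have "real (ix x) < x / h" "x / h \<le> real (ix x) + 1" unfolding eq by linarith+
    then show "real (ix x) * h < x" "x \<le> (real (ix x) + 1) * h"
      using h by (simp_all add: field_simps)
    have "x / h \<le> real K" using that s K by (simp add: h_def field_simps)
    then have "\<lceil>x / h\<rceil> \<le> int K" by (simp add: ceiling_le_iff)
    then show "ix x \<le> K - 1" using 1 K by (simp add: ix_def)
  qed
  have mono: "ix x \<le> ix y" if "x \<le> y" for x y
    unfolding ix_def using that h by (intro nat_mono diff_right_mono ceiling_mono divide_right_mono) auto
  have pos: "0 < fst (fst z)" "fst (fst z) \<le> s" "0 < snd (fst z)" "snd (fst z) \<le> s" if "z \<in> set xs" for z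
    using xs that by (auto simp: chains_def in_rect_def)
  have srt: "sorted_wrt (\<lambda>a b. lt2 (fst a) (fst b)) xs" using xs by (simp add: chains_def)
  define C where "C = fst ` set xs"
  have "\<exists>bs. length bs = 2 * K - 2 \<and> C \<subseteq> staircase h 0 0 bs"
  proof (rule staircase_cover[where c = "\<lambda>x. ix (fst x)" and r = "\<lambda>x. ix (snd x)"])
    fix x assume "x \<in> C"
    then obtain z where z: "z \<in> set xs" "x = fst z" by (auto simp: C_def)
    show "x \<in> square h (ix (fst x)) (ix (snd x))"
      using ix pos[OF z(1)] by (auto simp: square_def z(2) mem_Times_iff)
    show "0 \<le> ix (fst x) \<and> 0 \<le> ix (snd x) \<and> ix (fst x) + ix (snd x) \<le> 0 + 0 + (2 * K - 2)"
      using ix(3)[OF pos(1,2)[OF z(1)]] ix(3)[OF pos(3,4)[OF z(1)]] by (simp add: z(2))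
  next
    fix x y assume "x \<in> C" "y \<in> C"
    then obtain z w where z: "z \<in> set xs" "x = fst z" "w \<in> set xs" "y = fst w" by (auto simp: C_def)
    from sorted_wrt_comparable[OF srt z(1,3)]
    show "ix (fst x) \<le> ix (fst y) \<and> ix (snd x) \<le> ix (snd y) \<or> ix (fst y) \<le> ix (fst x) \<and> ix (snd y) \<le> ix (snd x)"
      by (auto simp: lt2_def z mono)
  qed
  then obtain bs where bs: "length bs = 2 * K - 2" "C \<subseteq> staircase h 0 0 bs" by blast
  let ?ys = "filter (\<lambda>z. u < snd z) xs"
  have "length ?ys = card (set ?ys)"
    using chains_distinct[OF xs] by (intro distinct_card[symmetric]) simp
  also have "\<dots> \<le> card (Q \<inter> staircase h 0 0 bs \<times> {u<..})"
  proof (rule card_mono)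
    show "finite (Q \<inter> staircase h 0 0 bs \<times> {u<..})" using fin[OF bs(1)] by (simp add: h_def)
    show "set ?ys \<subseteq> Q \<inter> staircase h 0 0 bs \<times> {u<..}"
      using chains_subset[OF xs] bs(2) by (auto simp: C_def mem_Times_iff)
  qed
  finally show ?thesis using bs(1) by (auto simp: h_def)
qed

text \<open>For positive \<open>w\<close> the sum counts the integers \<open>k\<close> with
  \<open>0 \<le> k < w\<close>, hence equals the ceiling of \<open>w\<close>.\<close>

lemma weight_le_sum_levels:
  assumes "w \<le> real m"
  shows "w \<le> (\<Sum>k<m. if real k < w then 1 else 0)"
  using assms
proof (induction m)
  case (Suc m)
  show ?case
  proof (cases "w \<le> real m")
    case True then show ?thesis using Suc by (simp add: add_increasing2)
  next
    case False
    then have "(\<Sum>k<Suc m. if real k < w then 1 else 0 :: real) = (\<Sum>k<Suc m. 1)"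
      by (intro sum.cong) auto
    then show ?thesis using Suc.prems by simp
  qed
qed simp

context marked_poisson_env begin

text \<open>The measurable majorant \<open>U\<close> stands in for the maximum over chains. The
  governing scale \<sigma> is the square root of the mean number of points of weight above
  \<open>u\<close> in the large square. For \<sigma> at least 1 this square is cut into about
  \<sigma> by \<sigma> smaller ones, each of Poisson mass at most 1.\<close>

lemma chain_count_bound:
  assumes s: "0 < s"
  shows "\<exists>U. U \<in> borel_measurable M \<and>
     (AE \<omega> in M. \<forall>xs\<in>chains (Q \<omega>) (0, 0) (s, s). ennreal (real (length (filter (\<lambda>z. u < snd z) xs))) \<le> U \<omega>) \<and>
     (\<integral>\<^sup>+\<omega>. U \<omega> \<partial>M) \<le> ennreal (12 * s * sqrt (measure D {u<..}))"
proof -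
  define q where "q = measure D {u<..}"
  have q0: "0 \<le> q" by (simp add: q_def)
  define \<sigma> where "\<sigma> = s * sqrt q"
  have \<sigma>0: "0 \<le> \<sigma>" using s q0 by (simp add: \<sigma>_def)
  have \<sigma>2: "s\<^sup>2 * q = \<sigma>\<^sup>2" using q0 by (simp add: \<sigma>_def power_mult_distrib)
  have em: "emeasure mu (A \<times> {u<..}) = emeasure lborel A * ennreal q" if "A \<in> sets borel" for A
    using that by (simp add: emeasure_mu_Times D.emeasure_eq_measure q_def)
  show ?thesis
  proof (cases "\<sigma> < 1")
    case True
    \<comment> \<open>Counting all points suffices here: their mean number is the square of
      \<sigma>, which is at most \<sigma> in this case.\<close>
    define B where "B = ({0<..s} \<times> {0<..s}) \<times> {u<..}"
    have B: "B \<in> sets borel" unfolding B_def by (intro borel_Times_borel) auto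
    have "emeasure mu B = ennreal (s\<^sup>2) * ennreal q"
      unfolding B_def using s
      by (subst em) (auto intro: borel_Times_borel simp: emeasure_lborel_Times power2_eq_square simp flip: ennreal_mult)
    also have "\<dots> = ennreal (\<sigma>\<^sup>2)" using q0 by (simp add: \<sigma>2 flip: ennreal_mult)
    finally have mB: "emeasure mu B = ennreal (\<sigma>\<^sup>2)" .
    then have fin: "emeasure mu B < \<infinity>" by simp
    note [measurable] = cnt_measurable[OF B fin]
    show ?thesis
    proof (intro exI[of _ "\<lambda>\<omega>. ennreal (real (cnt B \<omega>))"] conjI)
      show "AE \<omega> in M. \<forall>xs\<in>chains (Q \<omega>) (0, 0) (s, s).
          ennreal (real (length (filter (\<lambda>z. u < snd z) xs))) \<le> ennreal (real (cnt B \<omega>))"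
        using cnt_AE_finite[OF B fin]
      proof eventually_elim
        case (elim \<omega>)
        show ?case
        proof
          fix xs assume xs: "xs \<in> chains (Q \<omega>) (0, 0) (s, s)"
          let ?ys = "filter (\<lambda>z. u < snd z) xs"
          have "length ?ys = card (set ?ys)"
            using chains_distinct[OF xs] by (intro distinct_card[symmetric]) simp
          also have "\<dots> \<le> cnt B \<omega>"
            unfolding cnt_def using chains_subset[OF xs]
            by (intro card_mono elim) (auto simp: B_def rect_def in_rect_def mem_Times_iff)
          finally show "ennreal (real (length ?ys)) \<le> ennreal (real (cnt B \<omega>))"
            by (intro ennreal_leI) simp
        qed
      qed
      have "(\<integral>\<^sup>+\<omega>. ennreal (real (cnt B \<omega>)) \<partial>M) = ennreal (\<sigma>\<^sup>2)"
        using nn_integral_real_cnt[OF B fin] mB by (simp add: measure_def)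
      also have "\<dots> \<le> ennreal (12 * s * sqrt (measure D {u<..}))"
      proof (rule ennreal_leI)
        have "\<sigma>\<^sup>2 \<le> 1 * \<sigma>" unfolding power2_eq_square using True \<sigma>0 by (intro mult_right_mono) auto
        also have "\<dots> \<le> 12 * \<sigma>" using \<sigma>0 by simp
        finally show "\<sigma>\<^sup>2 \<le> 12 * s * sqrt (measure D {u<..})" by (simp add: \<sigma>_def q_def)
      qed
      finally show "(\<integral>\<^sup>+\<omega>. ennreal (real (cnt B \<omega>)) \<partial>M) \<le> ennreal (12 * s * sqrt (measure D {u<..}))" .
    qed measurable
  next
    case False
    \<comment> \<open>Rounding up makes the small squares light enough, and costs at most a factor 2
      because \<sigma> is at least 1.\<close>
    define K where "K = nat \<lceil>\<sigma>\<rceil>"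
    have K: "\<sigma> \<le> real K" "real K \<le> 2 * \<sigma>" "0 < K"
      using False unfolding K_def by linarith+
    define h where "h = s / K"
    have h: "0 < h" using s K by (simp add: h_def)
    have hq: "h\<^sup>2 * q \<le> 1"
    proof -
      have "h\<^sup>2 * q = (\<sigma> / K)\<^sup>2" by (simp add: h_def power_divide flip: \<sigma>2)
      also have "\<dots> \<le> 1" using K \<sigma>0 by (intro power_le_one) auto
      finally show ?thesis .
    qed
    define n where "n = 2 * K - 2"
    \<comment> \<open>The 3 is 2 + 1: the exponential moment of the count in one staircase is at
      most \<open>exp (2 * (real n + 1))\<close>, as \<open>exp 1 - 1 \<le> 2\<close>, and a further
      \<open>real n + 1\<close> outweighs the \<open>2 ^ n\<close> staircases.\<close>
    define a where "a = 3 * (real n + 1)"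
    define Bs where "Bs = {bs :: bool list. length bs = n}"
    have finBs: "finite Bs" and cardBs: "card Bs = 2 ^ n"
      using finite_lists_length_eq[of "UNIV :: bool set" n] card_lists_length_eq[of "UNIV :: bool set" n]
      by (simp_all add: Bs_def)
    define R where "R bs = staircase h 0 0 bs \<times> {u<..}" for bs
    have R: "R bs \<in> sets borel" for bs
      unfolding R_def by (intro borel_Times_borel staircase_borel) auto
    have mR: "emeasure mu (R bs) \<le> ennreal (real n + 1)" if "bs \<in> Bs" for bs
    proof -
      have "emeasure mu (R bs) \<le> ennreal ((real n + 1) * h\<^sup>2) * ennreal q"
        unfolding R_def em[OF staircase_borel]
        using emeasure_staircase[of h 0 0 bs] h that by (intro mult_right_mono) (auto simp: Bs_def)
      also have "\<dots> = ennreal ((real n + 1) * (h\<^sup>2 * q))" using q0 by (simp add: mult.assoc flip: ennreal_mult)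
      also have "\<dots> \<le> ennreal ((real n + 1) * 1)" by (intro ennreal_leI mult_left_mono hq) auto
      finally show ?thesis by simp
    qed
    then have finR: "emeasure mu (R bs) < \<infinity>" if "bs \<in> Bs" for bs
      using that by (metis ennreal_less_top infinity_ennreal_def le_less_trans)
    have mR': "measure mu (R bs) \<le> real n + 1" if "bs \<in> Bs" for bs
      unfolding measure_def by (rule enn2real_leI[OF _ mR[OF that]]) simp
    have [measurable]: "cnt (R bs) \<in> measurable M (count_space UNIV)" if "bs \<in> Bs" for bs
      using cnt_measurable[OF R finR[OF that]] .
    define U where "U \<omega> = ennreal a + (\<Sum>bs\<in>Bs. ennreal (exp (- a)) * ennreal (exp (real (cnt (R bs) \<omega>))))" for \<omega>
    show ?thesis
    proof (intro exI[of _ U] conjI)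
      show "U \<in> borel_measurable M" unfolding U_def by measurable
      have "AE \<omega> in M. \<forall>bs\<in>Bs. finite (Q \<omega> \<inter> R bs)"
        using finBs cnt_AE_finite[OF R finR] by (intro AE_finite_allI) auto
      then show "AE \<omega> in M. \<forall>xs\<in>chains (Q \<omega>) (0, 0) (s, s).
          ennreal (real (length (filter (\<lambda>z. u < snd z) xs))) \<le> U \<omega>"
      proof eventually_elim
        case (elim \<omega>)
        show ?case
        proof
          fix xs assume xs: "xs \<in> chains (Q \<omega>) (0, 0) (s, s)"
          obtain bs where bs: "bs \<in> Bs" "length (filter (\<lambda>z. u < snd z) xs) \<le> cnt (R bs) \<omega>"
            using chain_staircase[OF xs s K(3), of u] elim
            by (auto simp: Bs_def n_def R_def h_def cnt_def)
          let ?N = "real (cnt (R bs) \<omega>)"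
          \<comment> \<open>A maximum over exponentially many staircases is bounded by a sum of exponentials.\<close>
          have "?N \<le> a + exp (- a) * exp ?N"
          proof -
            have "exp (?N - a) = exp (- a) * exp ?N" by (simp flip: exp_add)
            then show ?thesis using exp_ge_add_one_self[of "?N - a"] by linarith
          qed
          then have "ennreal (real (length (filter (\<lambda>z. u < snd z) xs))) \<le> ennreal (a + exp (- a) * exp ?N)"
            using bs(2) by (intro ennreal_leI) linarith
          also have "\<dots> = ennreal a + ennreal (exp (- a)) * ennreal (exp ?N)"
            by (subst ennreal_plus) (auto simp: a_def ennreal_mult)
          also have "\<dots> \<le> U \<omega>"
            unfolding U_def using finBs bs(1) by (intro add_left_mono member_le_sum) auto
          finally show "ennreal (real (length (filter (\<lambda>z. u < snd z) xs))) \<le> U \<omega>" .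
        qed
      qed
      have "(\<integral>\<^sup>+\<omega>. U \<omega> \<partial>M) = ennreal a + (\<Sum>bs\<in>Bs. ennreal (exp (- a)) * ennreal (exp (measure mu (R bs) * (exp 1 - 1))))"
      proof -
        have "(\<integral>\<^sup>+\<omega>. (\<Sum>bs\<in>Bs. ennreal (exp (- a)) * ennreal (exp (real (cnt (R bs) \<omega>)))) \<partial>M)
            = (\<Sum>bs\<in>Bs. \<integral>\<^sup>+\<omega>. ennreal (exp (- a)) * ennreal (exp (real (cnt (R bs) \<omega>))) \<partial>M)"
          by (rule nn_integral_sum) measurable
        also have "\<dots> = (\<Sum>bs\<in>Bs. ennreal (exp (- a)) * ennreal (exp (measure mu (R bs) * (exp 1 - 1))))"
        proof (rule sum.cong[OF refl])
          fix bs assume bs: "bs \<in> Bs"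
          note [measurable] = cnt_measurable[OF R finR[OF bs]]
          show "(\<integral>\<^sup>+\<omega>. ennreal (exp (- a)) * ennreal (exp (real (cnt (R bs) \<omega>))) \<partial>M)
              = ennreal (exp (- a)) * ennreal (exp (measure mu (R bs) * (exp 1 - 1)))"
            unfolding nn_integral_exp_cnt[OF R finR[OF bs], symmetric] by (rule nn_integral_cmult) measurable
        qed
        finally show ?thesis
          unfolding U_def by (subst nn_integral_add) (measurable, simp add: emeasure_space_1)
      qed
      also have "\<dots> \<le> ennreal a + (\<Sum>bs\<in>Bs. ennreal (exp (- a) * exp (2 * (real n + 1))))"
      proof (intro add_left_mono sum_mono)
        fix bs assume bs: "bs \<in> Bs"
        have "measure mu (R bs) * (exp 1 - 1) \<le> (real n + 1) * 2"
          using mR'[OF bs] exp_le by (intro mult_mono) auto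
        then show "ennreal (exp (- a)) * ennreal (exp (measure mu (R bs) * (exp 1 - 1)))
            \<le> ennreal (exp (- a) * exp (2 * (real n + 1)))"
          by (simp add: mult.commute flip: ennreal_mult)
      qed
      also have "\<dots> = ennreal (a + 2 ^ n * exp (- (real n + 1)))"
      proof -
        have "exp (- a) * exp (2 * (real n + 1)) = exp (- (real n + 1))"
          by (simp add: a_def flip: exp_add)
        then have "(\<Sum>bs\<in>Bs. ennreal (exp (- a) * exp (2 * (real n + 1)))) = ennreal (2 ^ n * exp (- (real n + 1)))"
          by (subst sum_ennreal) (simp_all only: sum_constant cardBs of_nat_power of_nat_numeral exp_ge_zero)
        then show ?thesis by (simp only:) (rule ennreal_plus[symmetric], auto simp: a_def)
      qed
      also have "\<dots> \<le> ennreal (12 * s * sqrt (measure D {u<..}))"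
      proof (rule ennreal_leI)
        have "(2::real) ^ n \<le> exp 1 ^ n" using exp_ge_add_one_self[of 1] by (intro power_mono) auto
        also have "\<dots> = exp (real n)" using exp_of_nat_mult[of n "1::real"] by simp
        also have "\<dots> \<le> exp (real n + 1)" by simp
        finally have "2 ^ n * exp (- (real n + 1)) \<le> exp (real n + 1) * exp (- (real n + 1))"
          by (intro mult_right_mono) auto
        also have "\<dots> = 1" by (simp flip: exp_add)
        finally have "a + 2 ^ n * exp (- (real n + 1)) \<le> a + 1" by simp
        \<comment> \<open>Here \<open>n + 1 = 2 * K - 1\<close>, so
          \<open>a + 1 = 6 * K - 2\<close>; together with \<open>K \<le> 2 * \<sigma>\<close> this
          is the origin of the constant 12.\<close>
        also have "\<dots> \<le> 6 * real K" using K(3) by (simp add: a_def n_def of_nat_diff)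
        also have "\<dots> \<le> 12 * \<sigma>" using K(2) by simp
        finally show "a + 2 ^ n * exp (- (real n + 1)) \<le> 12 * s * sqrt (measure D {u<..})"
          by (simp add: \<sigma>_def q_def)
      qed
      finally show "(\<integral>\<^sup>+\<omega>. U \<omega> \<partial>M) \<le> ennreal (12 * s * sqrt (measure D {u<..}))" .
    qed
  qed
qed

text \<open>The square root of the tail decreases, so the term at \<open>Suc k\<close> is at most
  the integral over the unit interval to its left. The term at 0 has no such interval and is bounded
  by 1.\<close>

lemma tail_sum_le_integral:
  "(\<Sum>k. ennreal (sqrt (measure D {real k<..}))) \<le> 1 + (\<integral>\<^sup>+x\<in>{0..}. ennreal (sqrt (1 - cdf D x)) \<partial>lborel)"
proof -
  have tail: "measure D {x<..} = 1 - cdf D x" for x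
  proof -
    have "{x<..} = space D - {..x}" by auto
    then show ?thesis using D.prob_compl[of "{..x}"] by (simp add: cdf_def)
  qed
  have "(\<Sum>k. ennreal (sqrt (measure D {real (Suc k)<..})))
     = (\<Sum>k. \<integral>\<^sup>+x. ennreal (sqrt (measure D {real (Suc k)<..})) * indicator {real k..<real (Suc k)} x \<partial>lborel)"
    by (simp add: nn_integral_cmult)
  also have "\<dots> = (\<integral>\<^sup>+x. (\<Sum>k. ennreal (sqrt (measure D {real (Suc k)<..})) * indicator {real k..<real (Suc k)} x) \<partial>lborel)"
    by (intro nn_integral_suminf[symmetric]) auto
  also have "\<dots> \<le> (\<integral>\<^sup>+x\<in>{0..}. ennreal (sqrt (1 - cdf D x)) \<partial>lborel)"
  proof (rule nn_integral_mono)
    fix x :: real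
    have z: "indicator {real k..<real (Suc k)} x = (0::ennreal)" if "k \<noteq> nat \<lfloor>x\<rfloor>" for k
    proof -
      have "k = nat \<lfloor>x\<rfloor>" if "real k \<le> x" "x < real (Suc k)"
      proof -
        have "\<lfloor>x\<rfloor> = int k" using that by (simp add: floor_eq_iff)
        then show ?thesis by simp
      qed
      then show ?thesis using \<open>k \<noteq> nat \<lfloor>x\<rfloor>\<close> by (auto simp: indicator_def)
    qed
    define g :: "nat \<Rightarrow> ennreal" where
      "g k = ennreal (sqrt (measure D {real (Suc k)<..})) * indicator {real k..<real (Suc k)} x" for k
    have "(\<Sum>k. g k) = sum g {nat \<lfloor>x\<rfloor>}"
    proof (rule suminf_finite)
      fix k assume "k \<notin> {nat \<lfloor>x\<rfloor>}"
      then have "k \<noteq> nat \<lfloor>x\<rfloor>" by simp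
      then show "g k = 0" unfolding g_def by (subst z) auto
    qed simp
    then have "(\<Sum>k. ennreal (sqrt (measure D {real (Suc k)<..})) * indicator {real k..<real (Suc k)} x)
       = ennreal (sqrt (measure D {real (Suc (nat \<lfloor>x\<rfloor>))<..})) * indicator {real (nat \<lfloor>x\<rfloor>)..<real (Suc (nat \<lfloor>x\<rfloor>))} x"
      by (simp only: g_def sum.insert sum.empty finite.intros empty_iff not_False_eq_True add_0_right)
    also have "\<dots> \<le> ennreal (sqrt (1 - cdf D x)) * indicator {0..} x"
    proof (cases "x \<in> {real (nat \<lfloor>x\<rfloor>)..<real (Suc (nat \<lfloor>x\<rfloor>))}")
      case True
      then have "measure D {real (Suc (nat \<lfloor>x\<rfloor>))<..} \<le> measure D {x<..}"
        by (intro D.finite_measure_mono) auto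
      moreover have "0 \<le> x" using True by auto
      ultimately show ?thesis using True by (auto simp: tail intro!: ennreal_leI)
    qed auto
    finally show "(\<Sum>k. ennreal (sqrt (measure D {real (Suc k)<..})) * indicator {real k..<real (Suc k)} x)
       \<le> ennreal (sqrt (1 - cdf D x)) * indicator {0..} x" .
  qed
  finally have le: "(\<Sum>k. ennreal (sqrt (measure D {real (Suc k)<..}))) \<le> (\<integral>\<^sup>+x\<in>{0..}. ennreal (sqrt (1 - cdf D x)) \<partial>lborel)" .
  have le1: "ennreal (sqrt (measure D {real 0<..})) \<le> 1"
    using D.prob_le_1[of "{0<..}"] by simp
  have "(\<Sum>k. ennreal (sqrt (measure D {real k<..}))) =
      ennreal (sqrt (measure D {real 0<..})) + (\<Sum>k. ennreal (sqrt (measure D {real (Suc k)<..})))"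
    by (subst suminf_offset[where i = 1]) auto
  then show ?thesis using add_mono[OF le1 le] by (simp only:)
qed

text \<open>One optimal chain is sliced at all levels simultaneously. It is random and not tailored
  to any level, which is why each \<open>U k\<close> has to bound every chain.\<close>

lemma nn_integral_lpp_square_le:
  assumes s: "0 < s"
  shows "(\<integral>\<^sup>+\<omega>. ennreal (lpp (Q \<omega>) (0, 0) (s, s)) \<partial>M)
    \<le> ennreal (12 * s) * (1 + (\<integral>\<^sup>+x\<in>{0..}. ennreal (sqrt (1 - cdf D x)) \<partial>lborel))"
proof -
  define P where "P k U \<longleftrightarrow> U \<in> borel_measurable M \<and>
     (AE \<omega> in M. \<forall>xs\<in>chains (Q \<omega>) (0, 0) (s, s). ennreal (real (length (filter (\<lambda>z. real k < snd z) xs))) \<le> U \<omega>) \<and>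
     (\<integral>\<^sup>+\<omega>. U \<omega> \<partial>M) \<le> ennreal (12 * s * sqrt (measure D {real k<..}))" for k :: nat and U
  have "\<forall>k. \<exists>U. P k U" unfolding P_def using chain_count_bound[OF s] by blast
  then obtain U where P: "\<And>k. P k (U k)" using choice[of P] by blast
  have U[measurable]: "U k \<in> borel_measurable M"
    and AE_U: "AE \<omega> in M. \<forall>xs\<in>chains (Q \<omega>) (0, 0) (s, s). ennreal (real (length (filter (\<lambda>z. real k < snd z) xs))) \<le> U k \<omega>"
    and int_U: "(\<integral>\<^sup>+\<omega>. U k \<omega> \<partial>M) \<le> ennreal (12 * s * sqrt (measure D {real k<..}))" for k
    using P[of k] unfolding P_def by blast+
  have "AE \<omega> in M. general_position (Q \<omega> \<inter> rect (0, 0) (s, s))"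
    using s by (intro AE_general_position) auto
  moreover have "AE \<omega> in M. \<forall>k. \<forall>xs\<in>chains (Q \<omega>) (0, 0) (s, s). ennreal (real (length (filter (\<lambda>z. real k < snd z) xs))) \<le> U k \<omega>"
    using AE_U by (simp add: AE_all_countable)
  ultimately have "AE \<omega> in M. ennreal (lpp (Q \<omega>) (0, 0) (s, s)) \<le> (\<Sum>k. U k \<omega>)"
  proof eventually_elim
    case (elim \<omega>)
    then obtain xs where xs: "xs \<in> chains (Q \<omega>) (0, 0) (s, s)"
      "lpp (Q \<omega>) (0, 0) (s, s) = sum_list (map snd xs)"
      by (metis lpp_attained general_position_def)
    obtain m where m: "\<And>z. z \<in> set xs \<Longrightarrow> snd z \<le> real m"
    proof -
      have "bdd_above (snd ` set xs)" by simp
      then obtain c where "\<And>z. z \<in> set xs \<Longrightarrow> snd z \<le> c" by (auto simp: bdd_above_def)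
      moreover obtain m where "c \<le> real m" using real_arch_simple by blast
      ultimately show ?thesis using that[of m] by force
    qed
    have "sum_list (map snd xs) \<le> sum_list (map (\<lambda>z. \<Sum>k<m. if real k < snd z then 1 else 0) xs)"
      using m by (intro sum_list_mono weight_le_sum_levels) auto
    also have "\<dots> = (\<Sum>k<m. real (length (filter (\<lambda>z. real k < snd z) xs)))"
    proof -
      have "sum_list (map (\<lambda>z. \<Sum>k<m. if real k < snd z then 1 else 0) ys)
          = (\<Sum>k<m. real (length (filter (\<lambda>z. real k < snd z) ys)))" for ys :: "((real \<times> real) \<times> real) list"
        by (induction ys) (auto simp: sum.distrib[symmetric] intro!: sum.cong)
      then show ?thesis .
    qed
    finally have "ennreal (sum_list (map snd xs)) \<le> ennreal (\<Sum>k<m. real (length (filter (\<lambda>z. real k < snd z) xs)))"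
      by (rule ennreal_leI)
    also have "\<dots> = (\<Sum>k<m. ennreal (real (length (filter (\<lambda>z. real k < snd z) xs))))"
      by (simp only: sum_ennreal of_nat_0_le_iff)
    also have "\<dots> \<le> (\<Sum>k<m. U k \<omega>)" using elim xs(1) by (intro sum_mono) auto
    also have "\<dots> \<le> (\<Sum>k. U k \<omega>)" by (rule sum_le_suminf) auto
    finally show ?case by (simp add: xs(2))
  qed
  \<comment> \<open>Monotonicity of \<open>nn_integral\<close> asks for no measurability of
    \<open>lpp\<close>; only the majorants are integrated termwise.\<close>
  then have "(\<integral>\<^sup>+\<omega>. ennreal (lpp (Q \<omega>) (0, 0) (s, s)) \<partial>M) \<le> (\<integral>\<^sup>+\<omega>. (\<Sum>k. U k \<omega>) \<partial>M)"
    by (rule nn_integral_mono_AE)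
  also have "\<dots> = (\<Sum>k. \<integral>\<^sup>+\<omega>. U k \<omega> \<partial>M)" by (rule nn_integral_suminf) measurable
  also have "\<dots> \<le> (\<Sum>k. ennreal (12 * s) * ennreal (sqrt (measure D {real k<..})))"
    using int_U s by (intro suminf_le) (auto simp flip: ennreal_mult)
  also have "\<dots> = ennreal (12 * s) * (\<Sum>k. ennreal (sqrt (measure D {real k<..})))"
    by (rule ennreal_suminf_cmult)
  also have "\<dots> \<le> ennreal (12 * s) * (1 + (\<integral>\<^sup>+x\<in>{0..}. ennreal (sqrt (1 - cdf D x)) \<partial>lborel))"
    by (intro mult_left_mono tail_sum_le_integral) simp
  finally show ?thesis .
qed

end

section \<open>Convergence\<close>

locale marked_poisson_sqrt_tail = marked_poisson_env +
  assumes sqrt_tail: "(\<integral>\<^sup>+x\<in>{0..}. ennreal (sqrt (1 - cdf D x)) \<partial>lborel) < \<infinity>"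
begin

text \<open>The side of a square is the right parameter: every rectangle has the mean of the square
  of equal area, and squares stacked along the diagonal make these means superadditive in the
  side.\<close>

definition mean_lpp :: "real \<Rightarrow> real" where
  "mean_lpp s = expectation (lpp_version (0, 0) (s, s))"

definition tail_bound :: real where
  "tail_bound = 12 * (1 + enn2real (\<integral>\<^sup>+x\<in>{0..}. ennreal (sqrt (1 - cdf D x)) \<partial>lborel))"

lemma nn_integral_lpp:
  assumes "fst p < fst q" "snd p < snd q"
  shows "(\<integral>\<^sup>+\<omega>. ennreal (lpp (Q \<omega>) p q) \<partial>M) = (\<integral>\<^sup>+\<omega>. ennreal (lpp_version p q \<omega>) \<partial>M)"
  by (rule nn_integral_cong_AE) (use AE_lpp_version[OF assms] in eventually_elim, simp)

lemma nn_integral_lpp_version_square_le: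
  assumes "0 < s"
  shows "(\<integral>\<^sup>+\<omega>. ennreal (lpp_version (0, 0) (s, s) \<omega>) \<partial>M) \<le> ennreal (tail_bound * s)"
proof -
  let ?I = "\<integral>\<^sup>+x\<in>{0..}. ennreal (sqrt (1 - cdf D x)) \<partial>lborel"
  have "?I = ennreal (enn2real ?I)" using sqrt_tail by (simp add: ennreal_enn2real)
  then have "ennreal (12 * s) * (1 + ?I) = ennreal (12 * s) * (ennreal 1 + ennreal (enn2real ?I))" by simp
  also have "ennreal 1 + ennreal (enn2real ?I) = ennreal (1 + enn2real ?I)"
    by (rule ennreal_plus[symmetric]) auto
  also have "ennreal (12 * s) * ennreal (1 + enn2real ?I) = ennreal (12 * s * (1 + enn2real ?I))"
    by (rule ennreal_mult[symmetric]) (use assms in auto)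
  also have "12 * s * (1 + enn2real ?I) = tail_bound * s" by (simp add: tail_bound_def)
  finally show ?thesis
    using nn_integral_lpp_square_le[OF assms] nn_integral_lpp[of "(0, 0)" "(s, s)"] assms by simp
qed

lemma nn_integral_lpp_version_eq_square:
  assumes "fst p < fst q" "snd p < snd q"
  shows "(\<integral>\<^sup>+\<omega>. ennreal (lpp_version p q \<omega>) \<partial>M)
      = (\<integral>\<^sup>+\<omega>. ennreal (lpp_version (0, 0) (sqrt (area p q), sqrt (area p q)) \<omega>) \<partial>M)"
  using assms by (intro nn_integral_lpp_version_cong) (auto simp: area_def)

lemma integrable_lpp_version:
  assumes "fst p < fst q" "snd p < snd q"
  shows "integrable M (lpp_version p q)"
proof (rule integrableI_nonneg)
  have "0 < sqrt (area p q)" using assms by (simp add: area_def)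
  from nn_integral_lpp_version_square_le[OF this]
  show "(\<integral>\<^sup>+\<omega>. ennreal (lpp_version p q \<omega>) \<partial>M) < \<infinity>"
    unfolding nn_integral_lpp_version_eq_square[OF assms] by (metis ennreal_less_top infinity_ennreal_def le_less_trans)
qed (use assms in \<open>auto simp: lpp_version_nonneg lpp_version_measurable\<close>)

lemma expectation_lpp_version:
  assumes "fst p < fst q" "snd p < snd q"
  shows "expectation (lpp_version p q) = mean_lpp (sqrt (area p q))"
  unfolding mean_lpp_def
  using assms nn_integral_lpp_version_eq_square[OF assms]
  by (simp add: integral_eq_nn_integral lpp_version_nonneg lpp_version_measurable area_def)

lemma nn_integral_lpp_eq:
  assumes "fst p < fst q" "snd p < snd q"
  shows "(\<integral>\<^sup>+\<omega>. ennreal (lpp (Q \<omega>) p q) \<partial>M) = ennreal (mean_lpp (sqrt (area p q)))"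
  unfolding nn_integral_lpp[OF assms] expectation_lpp_version[OF assms, symmetric]
  by (rule nn_integral_eq_integral) (auto simp: integrable_lpp_version assms lpp_version_nonneg)

lemma mean_lpp_nonneg: "0 \<le> mean_lpp s"
  unfolding mean_lpp_def by (rule Bochner_Integration.integral_nonneg) (rule lpp_version_nonneg)

lemma mean_lpp_le:
  assumes "0 < s"
  shows "mean_lpp s \<le> tail_bound * s"
proof -
  have "ennreal (mean_lpp s) = (\<integral>\<^sup>+\<omega>. ennreal (lpp_version (0, 0) (s, s) \<omega>) \<partial>M)"
    unfolding mean_lpp_def
    by (rule nn_integral_eq_integral[symmetric]) (use assms in \<open>auto simp: integrable_lpp_version lpp_version_nonneg\<close>)
  then have "ennreal (mean_lpp s) \<le> ennreal (tail_bound * s)"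
    using nn_integral_lpp_version_square_le[OF assms] by simp
  moreover have "0 \<le> tail_bound * s" using assms by (simp add: tail_bound_def)
  ultimately show ?thesis by (simp add: ennreal_le_iff)
qed

lemma AE_lpp_version_superadditive:
  assumes "fst p < fst q" "snd p < snd q" "fst q < fst r" "snd q < snd r"
  shows "AE \<omega> in M. lpp_version p q \<omega> + lpp_version q r \<omega> \<le> lpp_version p r \<omega>"
proof -
  have pr: "fst p < fst r" "snd p < snd r" using assms by auto
  show ?thesis
    using AE_general_position[OF pr] AE_lpp_version[OF pr] AE_lpp_version[OF assms(1,2)] AE_lpp_version[OF assms(3,4)]
  proof eventually_elim
    case (elim \<omega>)
    then show ?case using assms lpp_superadditive[of "Q \<omega>" p r q] by (simp add: general_position_def)
  qed
qed

lemma mean_lpp_superadditive: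
  assumes "0 < s" "0 < t"
  shows "mean_lpp s + mean_lpp t \<le> mean_lpp (s + t)"
proof -
  have "area (s, s) (s + t, s + t) = t\<^sup>2" by (simp add: area_def power2_eq_square)
  then have "mean_lpp t = expectation (lpp_version (s, s) (s + t, s + t))"
    using expectation_lpp_version[of "(s, s)" "(s + t, s + t)"] assms by simp
  then have "mean_lpp s + mean_lpp t
      = expectation (\<lambda>\<omega>. lpp_version (0, 0) (s, s) \<omega> + lpp_version (s, s) (s + t, s + t) \<omega>)"
    using assms by (simp add: mean_lpp_def integrable_lpp_version)
  also have "\<dots> \<le> expectation (lpp_version (0, 0) (s + t, s + t))"
    using assms by (intro integral_mono_AE AE_lpp_version_superadditive)
      (auto intro!: integrable_lpp_version Bochner_Integration.integrable_add)
  finally show ?thesis by (simp add: mean_lpp_def)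
qed

section \<open>Finiteness of the constant and convergence of the means\<close>

lemma gamma_const_eq_SUP: "gamma_const M Q = (SUP n\<in>{1::nat..}. ennreal (mean_lpp (real n) / real n))"
  unfolding gamma_const_def
proof (rule SUP_cong[OF refl])
  fix n :: nat assume "n \<in> {1..}"
  then show "(\<integral>\<^sup>+\<omega>. ennreal (lpp (Q \<omega>) (0, 0) (real n, real n)) \<partial>M) / ennreal (real n)
      = ennreal (mean_lpp (real n) / real n)"
    using nn_integral_lpp_eq[of "(0, 0)" "(real n, real n)"]
    by (simp add: area_def divide_ennreal mean_lpp_nonneg)
qed

definition gam :: real where
  "gam = enn2real (gamma_const M Q)"

lemma gamma_const_finite: "gamma_const M Q < \<infinity>"
proof -
  have "gamma_const M Q \<le> ennreal tail_bound"
    unfolding gamma_const_eq_SUP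
    by (intro SUP_least ennreal_leI) (use mean_lpp_le in \<open>auto simp: field_simps\<close>)
  then show ?thesis by (metis ennreal_less_top infinity_ennreal_def le_less_trans)
qed

lemma gamma_const_eq: "gamma_const M Q = ennreal gam"
  using gamma_const_finite by (simp add: gam_def)

lemma gam_nonneg: "0 \<le> gam"
  by (simp add: gam_def)

lemma mean_lpp_nat_le:
  assumes "1 \<le> n"
  shows "mean_lpp (real n) \<le> gam * real n"
proof -
  have "ennreal (mean_lpp (real n) / real n) \<le> ennreal gam"
    unfolding gamma_const_eq[symmetric] gamma_const_eq_SUP using assms by (intro SUP_upper) auto
  then show ?thesis using assms gam_nonneg by (simp add: ennreal_le_iff field_simps)
qed

lemma gam_approx:
  assumes "0 < e"
  shows "\<exists>n\<ge>1. gam - e < mean_lpp (real n) / real n"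
proof (rule ccontr)
  assume "\<not> ?thesis"
  then have le: "mean_lpp (real n) / real n \<le> gam - e" if "1 \<le> n" for n using that by (auto simp: not_less)
  have "ennreal gam \<le> ennreal (gam - e)"
    unfolding gamma_const_eq[symmetric] unfolding gamma_const_eq_SUP
    using le by (intro SUP_least ennreal_leI) auto
  moreover have "0 \<le> gam - e" using le[of 1] mean_lpp_nonneg[of 1] by simp
  ultimately show False using assms by (simp add: ennreal_le_iff)
qed

lemma mean_lpp_tendsto: "((\<lambda>s. mean_lpp s / s) \<longlongrightarrow> gam) at_top"
  and mean_lpp_le_gam: "0 < s \<Longrightarrow> mean_lpp s \<le> gam * s"
proof -
  note lim = superadditive_limit[OF mean_lpp_nonneg mean_lpp_superadditive mean_lpp_nat_le gam_approx]
  show "((\<lambda>s. mean_lpp s / s) \<longlongrightarrow> gam) at_top" by (rule lim)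
  show "0 < s \<Longrightarrow> mean_lpp s \<le> gam * s" by (rule lim)
qed

lemma mean_lpp_scaled_tendsto:
  assumes "0 < s"
  shows "((\<lambda>r. mean_lpp (r * s) / r) \<longlongrightarrow> gam * s) at_top"
proof -
  have "filterlim (\<lambda>r. r * s) at_top at_top"
    using assms by (intro filterlim_at_top_mult_tendsto_pos[OF tendsto_const] filterlim_ident)
  from tendsto_mult[OF filterlim_compose[OF mean_lpp_tendsto this] tendsto_const[of s]]
  have "((\<lambda>r. mean_lpp (r * s) / (r * s) * s) \<longlongrightarrow> gam * s) at_top" .
  then show ?thesis using assms by simp
qed

text \<open>The square with the area of the rectangle of sides \<open>r * x\<close> and
  \<open>r * t\<close> has side \<open>r * sqrt (x * t)\<close>; this is where the square root in
  the limit comes from.\<close>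

lemma mean_convergence:
  assumes "0 < x" "0 < t"
  shows "((\<lambda>r::real. (\<integral>\<^sup>+\<omega>. ennreal (lpp (Q \<omega>) (0, 0) (r * x, r * t)) \<partial>M) / ennreal r)
     \<longlongrightarrow> gamma_const M Q * ennreal (sqrt (x * t))) at_top"
proof -
  have "((\<lambda>r. ennreal (mean_lpp (r * sqrt (x * t)) / r)) \<longlongrightarrow> ennreal (gam * sqrt (x * t))) at_top"
    using assms by (intro tendsto_ennrealI mean_lpp_scaled_tendsto) simp
  moreover have "\<forall>\<^sub>F r in at_top. ennreal (mean_lpp (r * sqrt (x * t)) / r)
      = (\<integral>\<^sup>+\<omega>. ennreal (lpp (Q \<omega>) (0, 0) (r * x, r * t)) \<partial>M) / ennreal r"
    using eventually_gt_at_top[of 0]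
  proof eventually_elim
    case (elim r)
    have "area (0, 0) (r * x, r * t) = r\<^sup>2 * (x * t)" by (simp add: area_def power2_eq_square)
    then have "sqrt (area (0, 0) (r * x, r * t)) = r * sqrt (x * t)"
      using elim by (simp add: real_sqrt_mult)
    then show ?case
      using elim assms nn_integral_lpp_eq[of "(0, 0)" "(r * x, r * t)"]
      by (simp add: divide_ennreal mean_lpp_nonneg)
  qed
  ultimately show ?thesis
    using gam_nonneg by (simp add: gamma_const_eq flip: ennreal_mult') (rule Lim_transform_eventually)
qed

text \<open>The rectangle from \<open>P k\<close> to \<open>P (Suc k)\<close> is a translate of the
  one from the origin to \<open>P k\<close> and disjoint from it. Its passage time is therefore the
  independent copy that the doubling argument asks for.\<close>

lemma AE_dyadic_convergence:
  assumes a: "0 < a" and b: "0 < b"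
  shows "AE \<omega> in M. (\<lambda>k. lpp (Q \<omega>) (0, 0) (2 ^ k * a, 2 ^ k * b) / 2 ^ k) \<longlonglongrightarrow> gam * sqrt (a * b)"
proof -
  define P where "P k = (2 ^ k * a, 2 ^ k * b)" for k :: nat
  have P: "fst (0, 0) < fst (P k)" "snd (0, 0) < snd (P k)" for k using a b by (auto simp: P_def)
  have PS: "fst (P k) < fst (P (Suc k))" "snd (P k) < snd (P (Suc k))" for k using a b by (auto simp: P_def)
  have area1: "area (0, 0) (P k) = (2 ^ k * sqrt (a * b))\<^sup>2" for k
    using a b by (simp add: area_def P_def power_mult_distrib) (simp add: power2_eq_square)
  have area2: "area (P k) (P (Suc k)) = area (0, 0) (P k)" for k
    by (simp add: area_def P_def)
  have disj: "rect (0, 0) (P k) \<inter> rect (P k) (P (Suc k)) = {}" for k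
    by (auto simp: rect_def in_rect_def)
  define X where "X k = lpp_version (0, 0) (P k)" for k
  define X' where "X' k = lpp_version (P k) (P (Suc k))" for k
  \<comment> \<open>The identities for expectations require functions bounded on the whole real
    line. The inner maximum, invisible on nonnegative passage times, achieves this.\<close>
  have eq: "max 0 (A - lpp_version p q \<omega>) = max 0 (A - max 0 (lpp_version p q \<omega>))" for A p q \<omega>
    using lpp_version_nonneg[of p q \<omega>] by simp
  have bound: "\<bar>max 0 (A - max 0 x)\<bar> \<le> \<bar>A\<bar>" for A x :: real by auto
  have bound2: "\<bar>(max 0 (A - max 0 x))\<^sup>2\<bar> \<le> \<bar>A\<bar>\<^sup>2" for A x :: real
    using power_mono[OF bound[of A x], of 2] by simp
  have cont: "continuous_on UNIV (\<lambda>x::real. max 0 (A - max 0 x))" for A by (intro continuous_intros)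
  have cont2: "continuous_on UNIV (\<lambda>x::real. (max 0 (A - max 0 x))\<^sup>2)" for A by (intro continuous_intros)
  have mean: "expectation (X k) = mean_lpp (2 ^ k * sqrt (a * b))" for k
    unfolding X_def expectation_lpp_version[OF P] area1 using a b by simp
  have "AE \<omega> in M. (\<lambda>k. X k \<omega> / 2 ^ k) \<longlonglongrightarrow> gam * sqrt (a * b)"
  proof (rule doubling_AE_tendsto[where X' = X'])
    fix A k
    show "expectation (\<lambda>x. max 0 (A - X' k x)) = expectation (\<lambda>x. max 0 (A - X k x))"
      unfolding X_def X'_def eq by (rule expectation_lpp_version_cong[OF PS P area2 cont bound])
    show "expectation (\<lambda>x. (max 0 (A - X' k x))\<^sup>2) = expectation (\<lambda>x. (max 0 (A - X k x))\<^sup>2)"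
      unfolding X_def X'_def eq by (rule expectation_lpp_version_cong[OF PS P area2 cont2 bound2])
    show "expectation (\<lambda>x. max 0 (A - X k x) * max 0 (A - X' k x))
       = expectation (\<lambda>x. max 0 (A - X k x)) * expectation (\<lambda>x. max 0 (A - X' k x))"
      unfolding X_def X'_def eq by (rule expectation_lpp_version_mult[OF P PS disj cont bound cont bound])
  next
    fix k
    show "expectation (X k) \<le> gam * sqrt (a * b) * 2 ^ k"
      using mean_lpp_le_gam[of "2 ^ k * sqrt (a * b)"] a b by (simp add: mean mult_ac)
    show "AE \<omega> in M. X k \<omega> + X' k \<omega> \<le> X (Suc k) \<omega>"
      unfolding X_def X'_def by (rule AE_lpp_version_superadditive[OF P PS])
  next
    have "filterlim (\<lambda>k. 2 ^ k :: real) at_top sequentially"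
      by (rule filterlim_realpow_sequentially_gt1[THEN filterlim_at_infinity_imp_filterlim_at_top]) auto
    from filterlim_compose[OF mean_lpp_scaled_tendsto this] a b
    show "(\<lambda>k. expectation (X k) / 2 ^ k) \<longlonglongrightarrow> gam * sqrt (a * b)" by (simp add: mean)
  qed (auto simp: X_def X'_def lpp_version_measurable[OF P] lpp_version_measurable[OF PS] integrable_lpp_version[OF P] lpp_version_nonneg)
  moreover have "AE \<omega> in M. \<forall>k. X k \<omega> = lpp (Q \<omega>) (0, 0) (P k)"
    unfolding X_def AE_all_countable using AE_lpp_version[OF P] by blast
  ultimately show ?thesis by eventually_elim (simp add: P_def)
qed

text \<open>Restricting the factors \<open>c\<close> to rationals leaves countably many exceptional
  sets, so outside a single null set all dyadic sequences converge and the interpolation is purely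
  deterministic.\<close>

lemma AE_convergence:
  assumes x: "0 < x" and t: "0 < t"
  shows "AE \<omega> in M. ((\<lambda>r::real. lpp (Q \<omega>) (0, 0) (r * x, r * t) / r) \<longlongrightarrow> gam * sqrt (x * t)) at_top"
proof -
  have "AE \<omega> in M. \<forall>c\<in>{c\<in>\<rat>. 0 < c}. (\<lambda>k. lpp (Q \<omega>) (0, 0) (2 ^ k * (c * x), 2 ^ k * (c * t)) / 2 ^ k)
      \<longlonglongrightarrow> gam * sqrt ((c * x) * (c * t))"
  proof (subst AE_ball_countable)
    show "countable {c \<in> \<rat>. (0::real) < c}" by (rule countable_subset[OF _ countable_rat]) auto
    show "\<forall>c\<in>{c\<in>\<rat>. 0 < c}. AE \<omega> in M. (\<lambda>k. lpp (Q \<omega>) (0, 0) (2 ^ k * (c * x), 2 ^ k * (c * t)) / 2 ^ k)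
      \<longlonglongrightarrow> gam * sqrt ((c * x) * (c * t))"
      using x t by (intro ballI AE_dyadic_convergence) auto
  qed
  \<comment> \<open>Monotonicity in \<open>r\<close> needs finitely many points in every rectangle
    at once; each rectangle with lower left corner at the origin lies in one of these integer
    squares.\<close>
  moreover have "AE \<omega> in M. \<forall>n. finite (Q \<omega> \<inter> rect (0, 0) (real (Suc n), real (Suc n)))"
    unfolding AE_all_countable
    using AE_general_position[of "(0, 0)" "(real (Suc n), real (Suc n))" for n]
    by (auto simp: general_position_def)
  ultimately show ?thesis
  proof eventually_elim
    case (elim \<omega>)
    have fin: "finite (Q \<omega> \<inter> rect (0, 0) q)" for q
    proof -
      obtain n where "max (fst q) (snd q) \<le> real n" using real_arch_simple by blast
      then have "rect (0, 0) q \<subseteq> rect (0, 0) (real (Suc n), real (Suc n))"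
        by (auto simp: rect_def in_rect_def)
      then show ?thesis using elim(2) by (meson Int_mono finite_subset order_refl)
    qed
    show ?case
    proof (rule dyadic_interpolation)
      fix r s :: real assume "0 < r" "r \<le> s"
      then show "lpp (Q \<omega>) (0, 0) (r * x, r * t) \<le> lpp (Q \<omega>) (0, 0) (s * x, s * t)"
        using x t by (intro lpp_mono fin) auto
    next
      show "0 \<le> gam * sqrt (x * t)" using gam_nonneg x t by simp
    next
      fix c :: real assume c: "c \<in> \<rat>" "0 < c"
      have "sqrt ((c * x) * (c * t)) = sqrt (c\<^sup>2 * (x * t))" by (simp add: power2_eq_square mult_ac)
      also have "\<dots> = c * sqrt (x * t)" using c by (simp add: real_sqrt_mult)
      finally have "gam * sqrt ((c * x) * (c * t)) = gam * sqrt (x * t) * c" by simp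
      moreover have "2 ^ k * (c * x) = c * 2 ^ k * x" "2 ^ k * (c * t) = c * 2 ^ k * t" for k :: nat by simp_all
      moreover have "(\<lambda>k. lpp (Q \<omega>) (0, 0) (2 ^ k * (c * x), 2 ^ k * (c * t)) / 2 ^ k)
          \<longlonglongrightarrow> gam * sqrt ((c * x) * (c * t))"
        using elim(1) c by blast
      ultimately show "(\<lambda>k. lpp (Q \<omega>) (0, 0) (c * 2 ^ k * x, c * 2 ^ k * t) / 2 ^ k) \<longlonglongrightarrow> gam * sqrt (x * t) * c"
        by (simp only:)
    qed
  qed
qed

end

theorem theorem1p1:
  fixes M :: "'w measure" and Q :: "'w \<Rightarrow> ((real \<times> real) \<times> real) set" and D :: "real measure"
  assumes "real_distribution D"
    and "measure D {..0} = 0"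
    and "marked_poisson M Q D"
    and "(\<integral>\<^sup>+x\<in>{0..}. ennreal (sqrt (1 - cdf D x)) \<partial>lborel) < \<infinity>"
  shows "gamma_const M Q < \<infinity> \<and>
    (\<forall>x t. x > 0 \<longrightarrow> t > 0 \<longrightarrow>
      ((\<lambda>r::real. (\<integral>\<^sup>+\<omega>. ennreal (lpp (Q \<omega>) (0,0) (r * x, r * t)) \<partial>M) / ennreal r)
         \<longlongrightarrow> gamma_const M Q * ennreal (sqrt (x * t))) at_top \<and>
      (AE \<omega> in M. ((\<lambda>r::real. lpp (Q \<omega>) (0,0) (r * x, r * t) / r)
         \<longlongrightarrow> enn2real (gamma_const M Q) * sqrt (x * t)) at_top))"
proof -
  interpret marked_poisson_sqrt_tail M Q D
    using assms
    by (intro marked_poisson_sqrt_tail.intro marked_poisson_env.intro marked_poisson_sqrt_tail_axioms.intro)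
  show ?thesis
    using gamma_const_finite mean_convergence AE_convergence by (simp add: gam_def)
qed

end
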